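(* Let $W_3(n)$ be the number of $3$-stack-sortable permutations in $S_n$. If the sequence $(W_3(n))_{n\ge1}$ is log-convex, i.e. $(W_3(n+1)/W_3(n))_{n\ge1}$ is nondecreasing, then $W_3(n)>\binom{4n}{n}$ for all sufficiently large $n$.
   Context: $S_n$ is the set of permutations of $\{1,\dots,n\}$. The stack-sorting map $s$: given an input permutation, repeatedly: if the stack is empty or the next input entry is smaller than the top of the stack, push the next input entry; otherwise pop the top of the stack to the end of the output. $s(\pi)$ is the final output. A permutation $\pi$ is $3$-stack-sortable if $s(s(s(\pi)))$ is increasing. *)

theory Defs
  imports Complex_Main "HOL-Combinatorics.Multiset_Permutations"
begin

text \<open>Permutations in $S_n$ are represented in one-line notation, as the elements of
  \<^term>\<open>permutations_of_set {1..n}\<close>.\<close>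

text \<open>The arguments are the remaining input, the stack (top first), and the output so far.
  Once the input is exhausted, only pops are possible.\<close>

fun stack_run :: "nat list \<Rightarrow> nat list \<Rightarrow> nat list \<Rightarrow> nat list" where
  "stack_run [] [] out = out"
| "stack_run [] (t # st) out = stack_run [] st (out @ [t])"
| "stack_run (x # xs) [] out = stack_run xs [x] out"
| "stack_run (x # xs) (t # st) out =
     (if x < t then stack_run xs (x # t # st) out else stack_run (x # xs) st (out @ [t]))"

definition stack_sort :: "nat list \<Rightarrow> nat list" where
  "stack_sort p = stack_run p [] []"

definition three_stack_sortable :: "nat list \<Rightarrow> bool" where
  "three_stack_sortable p \<longleftrightarrow> sorted_wrt (<) (stack_sort (stack_sort (stack_sort p)))"

definition W3 :: "nat \<Rightarrow> nat" where
  "W3 n = card {p \<in> permutations_of_set {1..n}. three_stack_sortable p}"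

end

theory Submission
  imports Defs "HOL-Library.More_List"
begin

text \<open>
  If all ratios $W_3(n+1)/W_3(n)$ were at most $256/27$, then $\sum_n W_3(n)x^n$ would converge at
  $x = 29/275 < 27/256$. This is refuted by a lower bound on the growth rate that does not use
  log-convexity. So some ratio, hence by log-convexity every later one, exceeds $256/27$ by a
  fixed factor, whereas $\binom{4n}{n} \le (256/27)^n$.

  For the growth rate, write $W_3(n) \ge \sum_\pi t_1(\pi)$ over the $\pi \in S_n$ with $s(s(\pi))$
  increasing, where $t_k(\pi)$ counts the sequences of $k$ nonempty words whose stack-sorted images
  concatenate to $\pi$ (in terms of decreasing binary plane trees: forests of $k$ trees with
  postorder $\pi$). Splitting $\pi = A\,n\,B$ at its maximum, $s(s(\pi))$ is increasing whenever
  $s(s(A))$ and $s(s(B))$ are and all of $A$ lies below $B$, except for $\max A$, which may be inserted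
  at any value that separates two sum-components of $s(B)$. With $v$ marking $k$, $z = 1 + u$ marking
  the sum-components of $s(\pi)$, and $H$ the generating function over nonempty $\pi$, this reads
  \[ H = xzv + xz\Bigl(\frac{(1+v)^2}{v}H - [v^1]H\Bigr)\Bigl(1 + H + \frac{H - [u^0]H}{u}\Bigr) + xzvH. \]
  Passing from $z$ to $u$ keeps all coefficients nonnegative, and makes the truncation to
  $v$-degree 13 and $u$-degree 6 already supercritical at $x = 29/275$: a few exactly verified Newton
  steps from below pass the bottleneck of the fixed-point iteration, after which it diverges
  along a fixed direction.
\<close>

section \<open>The stack-sorting map\<close>

lemma stack_run_out_append: "stack_run xs st (out @ out') = out @ stack_run xs st out'"
  by (induction xs st out' rule: stack_run.induct) simp_all

lemma stack_run_out: "stack_run xs st out = out @ stack_run xs st []"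
  using stack_run_out_append[of xs st out "[]"] by simp

lemma mset_stack_run: "mset (stack_run xs st out) = mset xs + mset st + mset out"
  by (induction xs st out rule: stack_run.induct) auto

lemma mset_stack_sort [simp]: "mset (stack_sort p) = mset p"
  by (simp add: stack_sort_def mset_stack_run)

lemma set_stack_sort [simp]: "set (stack_sort p) = set p"
  by (metis mset_stack_sort set_mset_mset)

lemma length_stack_sort [simp]: "length (stack_sort p) = length p"
  by (metis mset_stack_sort size_mset)

lemma distinct_stack_sort [simp]: "distinct (stack_sort p) = distinct p"
  by (metis mset_stack_sort mset_eq_imp_distinct_iff)

lemma stack_sort_Nil [simp]: "stack_sort [] = []"
  by (simp add: stack_sort_def)

text \<open>Only an input entry that is not smaller forces a pop, so \<open>m\<close> stays at the
  bottom until the input is exhausted and leaves the stack last.\<close>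

lemma stack_run_max_bottom:
  assumes "\<forall>x\<in>set R \<union> set st. x < m"
  shows "stack_run R (st @ [m]) out = stack_run R st out @ [m]"
  using assms by (induction R st out rule: stack_run.induct) auto

text \<open>The arrival of \<open>m\<close> empties the stack, in the same order in which it would
  be emptied if the input ended after \<open>L\<close>.\<close>

lemma stack_run_max_input:
  assumes "\<forall>x\<in>set L \<union> set st. x < m"
  shows "stack_run (L @ m # R) st out = stack_run R [m] (stack_run L st out)"
  using assms by (induction L st out rule: stack_run.induct) auto

text \<open>This is the postorder recursion of the decreasing binary tree with root
  \<open>m\<close>, left subtree \<open>L\<close> and right subtree \<open>R\<close>.\<close>

lemma stack_sort_max:
  assumes "\<forall>x\<in>set L \<union> set R. x < m"
  shows "stack_sort (L @ m # R) = stack_sort L @ stack_sort R @ [m]"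
proof -
  have "stack_sort (L @ m # R) = stack_run R ([] @ [m]) (stack_run L [] [])"
    using assms by (simp add: stack_sort_def stack_run_max_input)
  also have "\<dots> = stack_run R [] (stack_run L [] []) @ [m]"
    using assms by (intro stack_run_max_bottom) auto
  also have "\<dots> = stack_sort L @ stack_sort R @ [m]"
    by (subst stack_run_out) (simp add: stack_sort_def)
  finally show ?thesis .
qed

lemma stack_sort_snoc_max:
  assumes "\<forall>x\<in>set L. x < m"
  shows "stack_sort (L @ [m]) = stack_sort L @ [m]"
  using stack_sort_max[of L "[]" m] assms by simp

lemma split_at_max:
  assumes "distinct xs" "xs \<noteq> []"
  obtains L m R where "xs = L @ m # R" "\<forall>x\<in>set L \<union> set R. x < (m::nat)"
proof -
  have "Max (set xs) \<in> set xs" using assms by simp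
  then obtain L R where LR: "xs = L @ Max (set xs) # R" by (meson split_list)
  have "Max (set xs) \<notin> set L \<union> set R"
    using assms(1) LR by (metis Un_iff distinct_append distinct.simps(2) disjoint_iff list.set_intros(1))
  moreover have "\<forall>x\<in>set L \<union> set R. x \<in> set xs" by (subst LR) auto
  ultimately have "\<forall>x\<in>set L \<union> set R. x < Max (set xs)"
    by (metis List.finite_set Max_ge order_neq_le_trans)
  with LR that show thesis by blast
qed

text \<open>Since \<open>Y\<close> lies above \<open>X\<close>, the maximum of \<open>Y\<close> is
  that of the whole word; splitting there reduces \<open>Y\<close> to the part before its
  maximum.\<close>

lemma stack_sort_append_less:
  assumes "distinct Y" "\<forall>x\<in>set X. \<forall>y\<in>set Y. x < y"
  shows "stack_sort (X @ Y) = stack_sort X @ stack_sort Y"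
  using assms
proof (induction "length Y" arbitrary: Y rule: less_induct)
  case less
  show ?case
  proof (cases "Y = []")
    case False
    then obtain L m R where Y: "Y = L @ m # R" "\<forall>x\<in>set L \<union> set R. x < m"
      using less.prems(1) split_at_max by blast
    have "stack_sort (X @ Y) = stack_sort (X @ L) @ stack_sort R @ [m]"
      using stack_sort_max[of "X @ L" R m] Y less.prems(2) by auto
    also have "stack_sort (X @ L) = stack_sort X @ stack_sort L"
      using less.hyps[of L] less.prems Y by auto
    finally show ?thesis using stack_sort_max[of L R m] Y by simp
  qed simp
qed

text \<open>The run depends only on comparisons between entries, and a strictly increasing
  relabelling preserves these.\<close>

lemma stack_run_map:
  assumes "strict_mono_on (set xs \<union> set st) f"
  shows "stack_run (map f xs) (map f st) (map f out) = map f (stack_run xs st out)"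
  using assms
proof (induction xs st out rule: stack_run.induct)
  case (2 t st out)
  then have "strict_mono_on (set [] \<union> set st) f" by (auto intro: monotone_on_subset)
  then show ?case using 2(1) by simp
next
  case (3 x xs out)
  then have "strict_mono_on (set xs \<union> set [x]) f" by (auto intro: monotone_on_subset)
  then show ?case using 3(1) by simp
next
  case (4 x xs t st out)
  have eq: "f x < f t \<longleftrightarrow> x < t"
    using 4(3) by (intro strict_mono_on_less) auto
  show ?case
  proof (cases "x < t")
    case True
    have "strict_mono_on (set xs \<union> set (x # t # st)) f"
      using 4(3) by (auto intro: monotone_on_subset)
    then show ?thesis using 4(1)[OF True] eq True by simp
  next
    case False
    have "strict_mono_on (set (x # xs) \<union> set st) f"
      using 4(3) by (auto intro: monotone_on_subset)
    then show ?thesis using 4(2)[OF False] eq False by simp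
  qed
qed auto

lemma stack_sort_map:
  assumes "strict_mono_on (set p) f"
  shows "stack_sort (map f p) = map f (stack_sort p)"
  using stack_run_map[of p "[]" f "[]"] assms by (simp add: stack_sort_def)

lemma stack_sort_eq_Nil [simp]: "stack_sort p = [] \<longleftrightarrow> p = []"
  by (metis length_0_conv length_stack_sort)

section \<open>Forests with a given postorder\<close>

text \<open>For nonempty \<open>\<pi>\<close> and \<open>k = 1\<close> these are the preimages of
  \<open>\<pi>\<close> under the stack-sorting map, each wrapped in a list.\<close>

definition forests :: "nat list \<Rightarrow> nat \<Rightarrow> nat list list set" where
  "forests \<pi> k = {\<rho>s. length \<rho>s = k \<and> [] \<notin> set \<rho>s \<and> concat (map stack_sort \<rho>s) = \<pi>}"

lemma length_concat_stack_sort: "length (concat (map stack_sort \<rho>s)) = length (concat \<rho>s)"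
  by (induction \<rho>s) auto

lemma member_forests_subset: "\<rho>s \<in> forests \<pi> k \<Longrightarrow> \<rho> \<in> set \<rho>s \<Longrightarrow> set \<rho> \<subseteq> set \<pi>"
  unfolding forests_def by fastforce

lemma finite_forests [simp]: "finite (forests \<pi> k)"
proof -
  have "forests \<pi> k \<subseteq> {\<rho>s. set \<rho>s \<subseteq> {\<rho>. set \<rho> \<subseteq> set \<pi> \<and> length \<rho> \<le> length \<pi>} \<and> length \<rho>s = k}"
  proof safe
    fix \<rho>s \<rho> assume *: "\<rho>s \<in> forests \<pi> k" "\<rho> \<in> set \<rho>s"
    show "\<And>x. x \<in> set \<rho> \<Longrightarrow> x \<in> set \<pi>" using member_forests_subset[OF *] by blast
    have "length \<rho> \<le> length (concat \<rho>s)"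
      using *(2) by (simp add: length_concat member_le_sum_list)
    then show "length \<rho> \<le> length \<pi>"
      using * length_concat_stack_sort[of \<rho>s] by (simp add: forests_def)
  qed (auto simp: forests_def)
  then show ?thesis
    by (rule finite_subset) (intro finite_lists_length_eq finite_lists_length_le, simp)
qed

lemma card_forests_Nil: "card (forests [] k) = (if k = 0 then 1 else 0)"
proof -
  have "\<rho>s = []" if "\<rho>s \<in> forests [] k" for \<rho>s
    using that by (cases \<rho>s) (auto simp: forests_def)
  then have "\<rho>s \<in> forests [] k \<longleftrightarrow> \<rho>s = [] \<and> k = 0" for \<rho>s
    by (auto simp: forests_def)
  then have "forests [] k = (if k = 0 then {[]} else {})" by auto
  then show ?thesis by simp
qed

text \<open>Concatenating forests is injective: two cuts of one list whose left parts both have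
  image \<open>X\<close> differ by words with empty image, and empty words are excluded.\<close>

lemma card_forests_append:
  "(\<Sum>i\<le>k. card (forests X i) * card (forests Y (k - i))) \<le> card (forests (X @ Y) k)"
proof -
  let ?S = "SIGMA i:{..k}. forests X i \<times> forests Y (k - i)"
  let ?f = "\<lambda>(i, \<alpha>, \<beta>). \<alpha> @ \<beta>"
  have key: "\<alpha> = \<alpha>'" if pre: "\<alpha> @ \<beta> = \<alpha>' @ \<beta>'" "\<alpha> \<in> forests X i" "\<alpha>' \<in> forests X i'" "length \<alpha> \<le> length \<alpha>'"
    for \<alpha> \<alpha>' \<beta> \<beta>' :: "nat list list" and i i'
  proof -
    obtain \<gamma> where \<gamma>: "\<alpha>' = \<alpha> @ \<gamma>"
      using pre(1,4) by (metis append_eq_append_conv_if append_take_drop_id)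
    then have "concat (map stack_sort \<gamma>) = []" "[] \<notin> set \<gamma>"
      using pre(2,3) \<gamma> by (auto simp: forests_def)
    then have "\<gamma> = []" by (cases \<gamma>) auto
    then show ?thesis using \<gamma> by simp
  qed
  have "inj_on ?f ?S"
  proof (rule inj_onI)
    fix p q assume pq: "p \<in> ?S" "q \<in> ?S" "?f p = ?f q"
    obtain i \<alpha> \<beta> i' \<alpha>' \<beta>' where p: "p = (i, \<alpha>, \<beta>)" and q: "q = (i', \<alpha>', \<beta>')"
      by (cases p, cases q) auto
    have a: "\<alpha> @ \<beta> = \<alpha>' @ \<beta>'" "\<alpha> \<in> forests X i" "\<alpha>' \<in> forests X i'"
      using pq p q by auto
    have "\<alpha> = \<alpha>'"
      using key[OF a] key[OF a(1)[symmetric] a(3) a(2)] nat_le_linear by metis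
    then show "p = q" using a p q by (auto simp: forests_def)
  qed
  then have "card ?S = card (?f ` ?S)" by (simp add: card_image)
  also have "\<dots> \<le> card (forests (X @ Y) k)"
    by (intro card_mono finite_forests) (auto simp: forests_def)
  finally show ?thesis by simp
qed

text \<open>A last word \<open>L @ m # R\<close> contributes s(L) s(R) m, so deleting
  \<open>m\<close> leaves a forest of \<open>A\<close> whose last words are those of
  \<open>L\<close>, \<open>R\<close> that are nonempty. The coefficient 2 arises because a single
  nonempty part can be on either side of \<open>m\<close>.\<close>

lemma card_forests_snoc_max:
  assumes m: "\<forall>x\<in>set A. x < m"
  shows "card (forests A k) + 2 * card (forests A (Suc k)) + card (forests A (Suc (Suc k)))
         \<le> card (forests (A @ [m]) (Suc k))"
proof -
  define S where "S = {(\<alpha>, L, R). length \<alpha> = k \<and> [] \<notin> set \<alpha> \<and>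
      concat (map stack_sort \<alpha>) @ stack_sort L @ stack_sort R = A}"
  let ?f = "\<lambda>(\<alpha>, L, R). \<alpha> @ [L @ m # R]"
  have notin: "m \<notin> set L \<union> set R \<and> (\<forall>x\<in>set L \<union> set R. x < m)" if "(\<alpha>, L, R) \<in> S" for \<alpha> L R
  proof -
    have "set L \<union> set R \<subseteq> set A" using that by (auto simp: S_def)
    then show ?thesis using m by blast
  qed
  have inj: "inj_on ?f S"
  proof (rule inj_onI)
    fix p q assume pq: "p \<in> S" "q \<in> S" "?f p = ?f q"
    obtain \<alpha> L R \<alpha>' L' R' where p: "p = (\<alpha>, L, R)" and q: "q = (\<alpha>', L', R')"
      by (cases p, cases q) auto
    have a: "(\<alpha>, L, R) \<in> S" "(\<alpha>', L', R') \<in> S" "\<alpha> @ [L @ m # R] = \<alpha>' @ [L' @ m # R']"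
      using pq p q by auto
    have "L = L' \<and> R = R'"
      using a(3) notin[OF a(1)] notin[OF a(2)] by (simp add: append_Cons_eq_iff)
    then show "p = q" using a(3) p q by simp
  qed
  have sub: "?f ` S \<subseteq> forests (A @ [m]) (Suc k)"
  proof clarify
    fix \<alpha> L R assume a: "(\<alpha>, L, R) \<in> S"
    show "\<alpha> @ [L @ m # R] \<in> forests (A @ [m]) (Suc k)"
      using a stack_sort_max[of L R m] notin[OF a] by (auto simp: forests_def S_def)
  qed
  have finS: "finite S" using inj sub finite_forests finite_imageD finite_subset by metis
  \<comment> \<open>The four maps realise the four patterns of empty and nonempty \<open>L\<close>,
    \<open>R\<close>; they start from forests of \<open>k\<close>, \<open>k + 1\<close>,
    \<open>k + 1\<close> and \<open>k + 2\<close> words.\<close>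
  define g1 where "g1 = (\<lambda>\<alpha> :: nat list list. (\<alpha>, [] :: nat list, [] :: nat list))"
  define g2 where "g2 = (\<lambda>\<alpha> :: nat list list. (butlast \<alpha>, last \<alpha>, [] :: nat list))"
  define g3 where "g3 = (\<lambda>\<alpha> :: nat list list. (butlast \<alpha>, [] :: nat list, last \<alpha>))"
  define g4 where "g4 = (\<lambda>\<alpha> :: nat list list. (butlast (butlast \<alpha>), last (butlast \<alpha>), last \<alpha>))"
  have split: "\<alpha> = butlast \<alpha> @ [last \<alpha>]" "last \<alpha> \<noteq> []"
    "butlast \<alpha> \<in> forests (concat (map stack_sort (butlast \<alpha>))) j"
    "concat (map stack_sort (butlast \<alpha>)) @ stack_sort (last \<alpha>) = B"
    if \<alpha>: "\<alpha> \<in> forests B (Suc j)" for \<alpha> B j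
  proof -
    obtain \<beta> b where \<beta>: "\<alpha> = \<beta> @ [b]"
      using \<alpha> by (cases \<alpha> rule: rev_cases) (auto simp: forests_def)
    show "\<alpha> = butlast \<alpha> @ [last \<alpha>]" "last \<alpha> \<noteq> []"
      "butlast \<alpha> \<in> forests (concat (map stack_sort (butlast \<alpha>))) j"
      "concat (map stack_sort (butlast \<alpha>)) @ stack_sort (last \<alpha>) = B"
      using \<alpha> by (auto simp: forests_def \<beta>)
  qed
  have eqI: "\<alpha> = \<beta>" if "\<alpha> \<in> forests A (Suc j)" "\<beta> \<in> forests A (Suc j)"
    "butlast \<alpha> = butlast \<beta>" "last \<alpha> = last \<beta>" for \<alpha> \<beta> j
    using split(1)[OF that(1)] split(1)[OF that(2)] that(3,4) by simp
  have c1: "card (g1 ` forests A k) = card (forests A k)"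
    by (intro card_image inj_onI) (simp add: g1_def)
  have c2: "card (g2 ` forests A (Suc k)) = card (forests A (Suc k))"
    by (intro card_image inj_onI) (auto simp: g2_def intro: eqI)
  have c3: "card (g3 ` forests A (Suc k)) = card (forests A (Suc k))"
    by (intro card_image inj_onI) (auto simp: g3_def intro: eqI)
  have c4: "card (g4 ` forests A (Suc (Suc k))) = card (forests A (Suc (Suc k)))"
  proof (intro card_image inj_onI)
    fix \<alpha> \<beta> assume a: "\<alpha> \<in> forests A (Suc (Suc k))" "\<beta> \<in> forests A (Suc (Suc k))" "g4 \<alpha> = g4 \<beta>"
    have "butlast \<alpha> = butlast \<beta>"
      using split(1)[OF split(3)[OF a(1)]] split(1)[OF split(3)[OF a(2)]] a(3) by (simp add: g4_def)
    then show "\<alpha> = \<beta>" using eqI[OF a(1,2)] a(3) by (simp add: g4_def)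
  qed
  have s1: "g1 ` forests A k \<subseteq> S \<inter> {(\<alpha>, L, R). L = [] \<and> R = []}"
    by (auto simp: g1_def S_def forests_def)
  have s2: "g2 ` forests A (Suc k) \<subseteq> S \<inter> {(\<alpha>, L, R). L \<noteq> [] \<and> R = []}"
  proof (rule image_subsetI)
    fix \<alpha> assume a: "\<alpha> \<in> forests A (Suc k)"
    show "g2 \<alpha> \<in> S \<inter> {(\<alpha>, L, R). L \<noteq> [] \<and> R = []}"
      using split(2-4)[OF a] by (simp add: g2_def S_def forests_def)
  qed
  have s3: "g3 ` forests A (Suc k) \<subseteq> S \<inter> {(\<alpha>, L, R). L = [] \<and> R \<noteq> []}"
  proof (rule image_subsetI)
    fix \<alpha> assume a: "\<alpha> \<in> forests A (Suc k)"
    show "g3 \<alpha> \<in> S \<inter> {(\<alpha>, L, R). L = [] \<and> R \<noteq> []}"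
      using split(2-4)[OF a] by (simp add: g3_def S_def forests_def)
  qed
  have s4: "g4 ` forests A (Suc (Suc k)) \<subseteq> S \<inter> {(\<alpha>, L, R). L \<noteq> [] \<and> R \<noteq> []}"
  proof (rule image_subsetI)
    fix \<alpha> assume a: "\<alpha> \<in> forests A (Suc (Suc k))"
    note b = split(3)[OF a]
    have "concat (map stack_sort (butlast (butlast \<alpha>))) @ stack_sort (last (butlast \<alpha>)) @ stack_sort (last \<alpha>) = A"
      using split(4)[OF b] split(4)[OF a] by (metis append.assoc)
    then show "g4 \<alpha> \<in> S \<inter> {(\<alpha>, L, R). L \<noteq> [] \<and> R \<noteq> []}"
      using split(2)[OF a] split(2,3)[OF b] by (simp add: g4_def S_def forests_def)
  qed
  let ?P1 = "S \<inter> {(\<alpha>, L, R). L = [] \<and> R = []}" and ?P2 = "S \<inter> {(\<alpha>, L, R). L \<noteq> [] \<and> R = []}"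
  let ?P3 = "S \<inter> {(\<alpha>, L, R). L = [] \<and> R \<noteq> []}" and ?P4 = "S \<inter> {(\<alpha>, L, R). L \<noteq> [] \<and> R \<noteq> []}"
  have S: "S = (?P1 \<union> ?P2) \<union> (?P3 \<union> ?P4)" by auto
  have "card (forests A k) \<le> card ?P1" "card (forests A (Suc k)) \<le> card ?P2"
       "card (forests A (Suc k)) \<le> card ?P3" "card (forests A (Suc (Suc k))) \<le> card ?P4"
    using card_mono[OF _ s1] card_mono[OF _ s2] card_mono[OF _ s3] card_mono[OF _ s4] finS
    by (simp_all add: c1 c2 c3 c4)
  moreover have "card S = (card ?P1 + card ?P2) + (card ?P3 + card ?P4)"
  proof -
    have "card S = card (?P1 \<union> ?P2) + card (?P3 \<union> ?P4)"
      by (subst S, rule card_Un_disjoint) (use finS in auto)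
    also have "card (?P1 \<union> ?P2) = card ?P1 + card ?P2"
      by (rule card_Un_disjoint) (use finS in auto)
    also have "card (?P3 \<union> ?P4) = card ?P3 + card ?P4"
      by (rule card_Un_disjoint) (use finS in auto)
    finally show ?thesis .
  qed
  moreover have "card S \<le> card (forests (A @ [m]) (Suc k))"
    using card_inj_on_le[OF inj sub] by simp
  ultimately show ?thesis by linarith
qed

text \<open>Relabelling each word commutes with stack-sorting and is injective on words over the
  entries of \<open>\<pi>\<close>.\<close>

lemma card_forests_map:
  assumes f: "strict_mono_on (set \<pi>) f"
  shows "card (forests \<pi> k) \<le> card (forests (map f \<pi>) k)"
proof (rule card_inj_on_le)
  have inj: "inj_on f (set \<pi>)" using f by (rule strict_mono_on_imp_inj_on)
  show "inj_on (map (map f)) (forests \<pi> k)"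
  proof (rule inj_onI)
    fix \<rho>s \<rho>s' assume a: "\<rho>s \<in> forests \<pi> k" "\<rho>s' \<in> forests \<pi> k" "map (map f) \<rho>s = map (map f) \<rho>s'"
    have "inj_on (map f) (set \<rho>s \<union> set \<rho>s')"
    proof (rule inj_onI)
      fix x y assume b: "x \<in> set \<rho>s \<union> set \<rho>s'" "y \<in> set \<rho>s \<union> set \<rho>s'" "map f x = map f y"
      then have "set x \<union> set y \<subseteq> set \<pi>" using a(1,2) member_forests_subset by blast
      then show "x = y" using b(3) inj by (metis inj_on_map_eq_map inj_on_subset)
    qed
    then show "\<rho>s = \<rho>s'" using a(3) inj_on_map_eq_map by metis
  qed
  show "map (map f) ` forests \<pi> k \<subseteq> forests (map f \<pi>) k"
  proof clarify
    fix \<rho>s assume a: "\<rho>s \<in> forests \<pi> k"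
    have "map stack_sort (map (map f) \<rho>s) = map (map f) (map stack_sort \<rho>s)"
      using member_forests_subset[OF a] f by (auto intro!: stack_sort_map intro: monotone_on_subset)
    then have "concat (map stack_sort (map (map f) \<rho>s)) = map f (concat (map stack_sort \<rho>s))"
      by (simp only: map_concat)
    then show "map (map f) \<rho>s \<in> forests (map f \<pi>) k"
      using a by (auto simp: forests_def)
  qed
qed simp

section \<open>Gluing 2-stack-sortable permutations\<close>

definition two_sortable :: "nat \<Rightarrow> nat list set" where
  "two_sortable n = {\<pi>. set \<pi> = {1..n} \<and> distinct \<pi> \<and> sorted (stack_sort (stack_sort \<pi>))}"

text \<open>The positions where \<open>\<tau>\<close> splits as a direct sum. For a permutation of
  1..n both ends 0 and n belong to it.\<close>

definition cuts :: "nat list \<Rightarrow> nat set" where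
  "cuts \<tau> = {i. i \<le> length \<tau> \<and> set (take i \<tau>) = {1..i}}"

text \<open>The number of sum-components of \<^term>\<open>stack_sort \<pi>\<close>: the trivial cut 0 is not counted.\<close>

definition comps :: "nat list \<Rightarrow> nat" where
  "comps \<pi> = card (cuts (stack_sort \<pi>)) - 1"

lemma finite_cuts [simp]: "finite (cuts \<tau>)"
  by (rule finite_subset[of _ "{..length \<tau>}"]) (auto simp: cuts_def)

lemma zero_in_cuts [simp]: "0 \<in> cuts \<tau>"
  by (simp add: cuts_def)

lemma card_cuts_stack_sort: "card (cuts (stack_sort \<pi>)) = Suc (comps \<pi>)"
proof -
  have "card (cuts (stack_sort \<pi>)) > 0"
    using zero_in_cuts[of "stack_sort \<pi>"] by (metis card_gt_0_iff empty_iff finite_cuts)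
  then show ?thesis by (simp add: comps_def)
qed

lemma length_two_sortable: "\<pi> \<in> two_sortable n \<Longrightarrow> length \<pi> = n"
  unfolding two_sortable_def by (auto dest: distinct_card)

lemma finite_two_sortable [simp]: "finite (two_sortable n)"
proof (rule finite_subset)
  show "two_sortable n \<subseteq> permutations_of_set {1..n}"
    by (auto simp: two_sortable_def permutations_of_set_def)
qed simp

lemma two_sortable_0: "two_sortable 0 = {[]}"
  by (auto simp: two_sortable_def)

lemma comps_Nil: "comps [] = 0"
proof -
  have "cuts [] = {0}" by (auto simp: cuts_def)
  then show ?thesis by (simp add: comps_def)
qed

text \<open>As \<open>c\<close> runs down through \<open>E\<close>, the number of elements that are
  at least \<open>c\<close> takes each value 1, ..., \<open>card E\<close> once. It serves to sum
  over the cut at which the maximum of \<open>A\<close> is inserted.\<close>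

lemma sum_rank:
  fixes E :: "nat set"
  assumes "finite E"
  shows "(\<Sum>c\<in>E. f (card {y\<in>E. c \<le> y})) = (\<Sum>i<card E. f (Suc i))"
  using assms
proof (induction E rule: finite_linorder_min_induct)
  case (insert b A)
  have "{y \<in> insert b A. c \<le> y} = {y\<in>A. c \<le> y}" if "c \<in> A" for c
    using insert.hyps(2) that by auto
  then have "(\<Sum>c\<in>A. f (card {y \<in> insert b A. c \<le> y})) = (\<Sum>i<card A. f (Suc i))"
    using insert.IH by simp
  moreover have "{y \<in> insert b A. b \<le> y} = insert b A"
    using insert.hyps(2) by auto
  moreover have "b \<notin> A" using insert.hyps(2) by auto
  ultimately show ?case using insert.hyps(1) by (simp add: add.commute)
qed simp

text \<open>The case of an empty part before the maximum: sorting moves \<open>Suc n\<close> to the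
  end, where it forms a sum-component of its own.\<close>

lemma Cons_max_two_sortable:
  assumes B: "B \<in> two_sortable n"
  shows "Suc n # B \<in> two_sortable (Suc n)" and "Suc (comps B) \<le> comps (Suc n # B)"
proof -
  have setB: "set B = {1..n}" and dB: "distinct B" and lenB: "length B = n"
    using B length_two_sortable[OF B] by (auto simp: two_sortable_def)
  have s: "stack_sort (Suc n # B) = stack_sort B @ [Suc n]"
    using stack_sort_max[of "[]" B "Suc n"] setB by simp
  have "stack_sort (stack_sort (Suc n # B)) = stack_sort (stack_sort B) @ [Suc n]"
    unfolding s by (intro stack_sort_snoc_max) (simp add: setB)
  then have "sorted (stack_sort (stack_sort (Suc n # B)))"
    using B by (auto simp: two_sortable_def sorted_append)
  then show "Suc n # B \<in> two_sortable (Suc n)"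
    using setB dB by (auto simp: two_sortable_def)
  have "insert (Suc n) (cuts (stack_sort B)) \<subseteq> cuts (stack_sort (Suc n # B))"
  proof (intro insert_subsetI subsetI)
    show "Suc n \<in> cuts (stack_sort (Suc n # B))"
      by (simp add: cuts_def s lenB setB atLeastAtMostSuc_conv)
  next
    fix i assume "i \<in> cuts (stack_sort B)"
    then show "i \<in> cuts (stack_sort (Suc n # B))" by (simp add: cuts_def s)
  qed
  then have "card (insert (Suc n) (cuts (stack_sort B))) \<le> card (cuts (stack_sort (Suc n # B)))"
    by (intro card_mono) simp_all
  moreover have "Suc n \<notin> cuts (stack_sort B)" by (simp add: cuts_def lenB)
  ultimately show "Suc (comps B) \<le> comps (Suc n # B)"
    by (simp add: card_cuts_stack_sort)
qed

text \<open>
  Relabellings of the parts of \<^term>\<open>A @ m # B\<close> with \<^term>\<open>a = length A\<close>: the maximum of \<^term>\<open>A\<close> is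
  inserted just above the \<^term>\<open>c\<close> smallest values of \<^term>\<open>B\<close>.
\<close>

definition lift_max :: "nat \<Rightarrow> nat \<Rightarrow> nat \<Rightarrow> nat" where
  "lift_max a c x = (if x = a then a + c else x)"

definition lift_gap :: "nat \<Rightarrow> nat \<Rightarrow> nat \<Rightarrow> nat" where
  "lift_gap a c x = (if x \<le> c then a + x - 1 else a + x)"

definition glue :: "nat \<Rightarrow> nat \<Rightarrow> nat list \<Rightarrow> nat list \<Rightarrow> nat list" where
  "glue n c A B = map (lift_max (length A) c) A @ Suc n # map (lift_gap (length A) c) B"

lemma strict_mono_lift_max: "strict_mono_on {1..a} (lift_max a c)"
  by (auto simp: strict_mono_on_def lift_max_def)

lemma strict_mono_lift_gap: "1 \<le> a \<Longrightarrow> strict_mono_on {1..b} (lift_gap a c)"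
  by (auto simp: strict_mono_on_def lift_gap_def)

lemma lift_max_image: "1 \<le> a \<Longrightarrow> lift_max a c ` {1..a} = {1..<a} \<union> {a + c}"
  by (force simp: lift_max_def image_iff)

lemma lift_gap_image_low: "1 \<le> a \<Longrightarrow> i \<le> c \<Longrightarrow> lift_gap a c ` {1..i} = {a..<a + i}"
proof (intro equalityI subsetI)
  fix x assume "1 \<le> a" "i \<le> c" "x \<in> {a..<a + i}"
  then have "x = lift_gap a c (x - a + 1)" "x - a + 1 \<in> {1..i}" by (auto simp: lift_gap_def)
  then show "x \<in> lift_gap a c ` {1..i}" by blast
qed (auto simp: lift_gap_def)

lemma lift_gap_image_high: "1 \<le> a \<Longrightarrow> lift_gap a c ` {Suc c..b} = {a + Suc c..a + b}"
proof (intro equalityI subsetI)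
  fix x assume "1 \<le> a" "x \<in> {a + Suc c..a + b}"
  then have "x = lift_gap a c (x - a)" "x - a \<in> {Suc c..b}" by (auto simp: lift_gap_def)
  then show "x \<in> lift_gap a c ` {Suc c..b}" by blast
qed (auto simp: lift_gap_def)

lemma lift_gap_image:
  assumes "1 \<le> a" "c \<le> i"
  shows "lift_gap a c ` {1..i} = {a..<a + c} \<union> {a + Suc c..a + i}"
proof -
  have "{1..i} = {1..c} \<union> {Suc c..i}" using assms by auto
  then show ?thesis
    by (simp only: image_Un lift_gap_image_low[OF assms(1) order.refl] lift_gap_image_high[OF assms(1)])
qed

text \<open>Let s(A) = \<alpha> a, and split s(B) = \<beta>1 \<beta>2 at the cut \<open>c\<close>.
  With primes for relabelling, the first pass yields \<alpha> (a+c) \<beta>1' \<beta>2' (n+1). As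
  \<open>c\<close> is a cut, a+c lies above \<beta>1' and below \<beta>2', so the second pass only
  moves a+c behind \<beta>1' and sorts the blocks \<alpha>, \<beta>1', \<beta>2' separately.\<close>

lemma glue_two_sortable:
  assumes A: "A \<in> two_sortable a" and a: "1 \<le> a" and B: "B \<in> two_sortable b"
    and c: "c \<in> cuts (stack_sort B)" and n: "n = a + b"
  shows "glue n c A B \<in> two_sortable (Suc n)"
    and "comps A + card {y \<in> cuts (stack_sort B). c \<le> y} \<le> comps (glue n c A B)"
proof -
  have setA: "set A = {1..a}" and dA: "distinct A" and lenA: "length A = a"
    using A length_two_sortable[OF A] by (auto simp: two_sortable_def)
  have setB: "set B = {1..b}" and dB: "distinct B" and lenB: "length B = b"
    using B length_two_sortable[OF B] by (auto simp: two_sortable_def)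
  have cb: "c \<le> b" using c lenB by (auto simp: cuts_def)
  let ?f = "lift_max a c" and ?g = "lift_gap a c"
  obtain L m R where LR: "A = L @ m # R" "\<forall>x\<in>set L \<union> set R. x < m"
    using split_at_max[OF dA] setA a by (metis atLeastatMost_empty_iff2 list.set(1) not_less)
  have "m = a"
  proof -
    have "m \<in> set A" using LR(1) by simp
    then have "m \<le> a" using setA by simp
    have "a \<in> set A" using setA a by simp
    then have "a \<in> set L \<union> set R \<or> a = m" using LR(1) by auto
    then show ?thesis using LR(2) \<open>m \<le> a\<close> by (metis not_less)
  qed
  define \<alpha> where "\<alpha> = stack_sort L @ stack_sort R"
  have sA: "stack_sort A = \<alpha> @ [a]"
    using stack_sort_max[OF LR(2)] LR(1) \<open>m = a\<close> by (simp add: \<alpha>_def)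
  have d\<alpha>: "distinct (\<alpha> @ [a])" using dA by (simp flip: sA)
  have set\<alpha>a: "set (\<alpha> @ [a]) = {1..a}" using setA by (simp flip: sA)
  have set\<alpha>: "set \<alpha> = {1..<a}"
  proof -
    have "set \<alpha> = {1..a} - {a}" unfolding set\<alpha>a[symmetric] using d\<alpha> by simp
    also have "\<dots> = {1..<a}" by (simp add: set_eq_iff) linarith
    finally show ?thesis .
  qed
  have len\<alpha>: "length \<alpha> = a - 1" using lenA arg_cong[OF sA, of length] by simp
  define \<beta> where "\<beta> = stack_sort B"
  define \<beta>1 where "\<beta>1 = take c \<beta>"
  define \<beta>2 where "\<beta>2 = drop c \<beta>"
  have \<beta>: "\<beta> = \<beta>1 @ \<beta>2" by (simp add: \<beta>1_def \<beta>2_def)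
  have set\<beta>: "set \<beta> = {1..b}" and d\<beta>: "distinct \<beta>" and len\<beta>: "length \<beta> = b"
    using setB dB lenB by (auto simp: \<beta>_def)
  have set\<beta>1: "set \<beta>1 = {1..c}" using c by (simp add: \<beta>1_def \<beta>_def cuts_def)
  have set\<beta>2: "set \<beta>2 = {Suc c..b}"
  proof -
    have "set \<beta>2 = {1..b} - {1..c}"
      unfolding set\<beta>1[symmetric] set\<beta>[symmetric] using d\<beta> unfolding \<beta> by auto
    also have "\<dots> = {Suc c..b}" by (simp add: set_eq_iff) linarith
    finally show ?thesis .
  qed
  have mf: "strict_mono_on (set A) ?f" and mg: "strict_mono_on (set B) ?g"
    using strict_mono_lift_max strict_mono_lift_gap[OF a] setA setB by auto
  have \<alpha>f: "map ?f \<alpha> = \<alpha>"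
    by (rule map_idI) (simp add: set\<alpha> lift_max_def)
  have sfA: "stack_sort (map ?f A) = \<alpha> @ [a + c]"
    using stack_sort_map[OF mf] \<alpha>f by (simp add: sA lift_max_def)
  have sgB: "stack_sort (map ?g B) = map ?g \<beta>1 @ map ?g \<beta>2"
    using stack_sort_map[OF mg] by (simp add: \<beta> flip: \<beta>_def map_append)
  have setg1: "set (map ?g \<beta>1) = {a..<a + c}"
    using lift_gap_image_low[OF a order.refl, of c] set\<beta>1 by simp
  have setg2: "set (map ?g \<beta>2) = {a + Suc c..a + b}"
    using lift_gap_image_high[OF a] set\<beta>2 by simp
  have setfA: "set (map ?f A) = {1..<a} \<union> {a + c}"
    using lift_max_image[OF a] setA by simp
  have setgB: "set (map ?g B) = {a..<a + c} \<union> {a + Suc c..a + b}"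
    using lift_gap_image[OF a cb] setB by simp
  let ?\<pi> = "glue n c A B"
  have \<pi>: "?\<pi> = map ?f A @ Suc n # map ?g B" by (simp add: glue_def lenA)
  have s\<pi>: "stack_sort ?\<pi> = (\<alpha> @ (a + c) # map ?g \<beta>1 @ map ?g \<beta>2) @ [Suc n]"
  proof -
    have "\<forall>x \<in> set (map ?f A) \<union> set (map ?g B). x < Suc n"
      unfolding setfA setgB using cb n by auto
    from stack_sort_max[OF this] show ?thesis by (simp add: \<pi> sfA sgB)
  qed
  have dfA: "distinct (map ?f A)" and dgB: "distinct (map ?g B)"
    using dA dB strict_mono_on_imp_inj_on[OF mf] strict_mono_on_imp_inj_on[OF mg]
    by (simp_all add: distinct_map)
  have set\<pi>: "set ?\<pi> = {1..Suc n}"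
  proof -
    have "set ?\<pi> = ({1..<a} \<union> {a + c}) \<union> ({a..<a + c} \<union> {a + Suc c..a + b}) \<union> {Suc n}"
      unfolding \<pi> set_append list.set(2) setfA setgB by blast
    also have "\<dots> = {1..Suc n}" using a cb n by auto
    finally show ?thesis .
  qed
  have d\<pi>: "distinct ?\<pi>"
    using dfA dgB setfA setgB cb n unfolding \<pi> by auto
  have dg: "distinct (map ?g \<beta>1)" "distinct (map ?g \<beta>2)"
    using d\<pi> by (metis distinct_append distinct.simps(2) distinct_stack_sort s\<pi>)+
  have "stack_sort (stack_sort ?\<pi>)
      = stack_sort \<alpha> @ (stack_sort (map ?g \<beta>1) @ [a + c]) @ stack_sort (map ?g \<beta>2) @ [Suc n]"
  proof -
    have "stack_sort (stack_sort ?\<pi>) = stack_sort (\<alpha> @ ((a + c) # map ?g \<beta>1) @ map ?g \<beta>2) @ [Suc n]"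
      unfolding s\<pi> append_Cons
      by (rule stack_sort_snoc_max) (use n cb set\<alpha> setg1 setg2 in auto)
    also have "stack_sort (\<alpha> @ ((a + c) # map ?g \<beta>1) @ map ?g \<beta>2)
        = stack_sort (\<alpha> @ ((a + c) # map ?g \<beta>1)) @ stack_sort (map ?g \<beta>2)"
    proof -
      have "\<forall>x\<in>set (\<alpha> @ ((a + c) # map ?g \<beta>1)). \<forall>y\<in>set (map ?g \<beta>2). x < y"
        unfolding set_append list.set(2) set\<alpha> setg1 setg2 by auto
      from stack_sort_append_less[OF dg(2) this] show ?thesis by simp
    qed
    also have "stack_sort (\<alpha> @ ((a + c) # map ?g \<beta>1)) = stack_sort \<alpha> @ stack_sort ((a + c) # map ?g \<beta>1)"
    proof (rule stack_sort_append_less)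
      have "a + c \<notin> set (map ?g \<beta>1)" unfolding setg1 by simp
      then show "distinct ((a + c) # map ?g \<beta>1)" using dg(1) by simp
      show "\<forall>x\<in>set \<alpha>. \<forall>y\<in>set ((a + c) # map ?g \<beta>1). x < y"
        unfolding list.set(2) set\<alpha> setg1 by auto
    qed
    also have "stack_sort ((a + c) # map ?g \<beta>1) = stack_sort (map ?g \<beta>1) @ [a + c]"
    proof -
      have "\<forall>x\<in>set [] \<union> set (map ?g \<beta>1). x < a + c" unfolding setg1 by simp
      from stack_sort_max[OF this] show ?thesis by simp
    qed
    finally show ?thesis by simp
  qed
  moreover have "sorted (stack_sort \<alpha>)"
  proof -
    have "stack_sort (stack_sort A) = stack_sort \<alpha> @ [a]"
      unfolding sA by (rule stack_sort_snoc_max) (simp add: set\<alpha>)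
    then show ?thesis using A by (simp add: two_sortable_def sorted_append)
  qed
  moreover have "sorted (stack_sort (map ?g \<beta>1)) \<and> sorted (stack_sort (map ?g \<beta>2))"
  proof -
    have ms: "strict_mono_on (set \<beta>) ?g" using mg set\<beta> setB by simp
    have "stack_sort (map ?g \<beta>) = map ?g (stack_sort \<beta>)" by (rule stack_sort_map[OF ms])
    moreover have "stack_sort (map ?g \<beta>) = stack_sort (map ?g \<beta>1) @ stack_sort (map ?g \<beta>2)"
      unfolding \<beta> map_append
    proof (rule stack_sort_append_less[OF dg(2)])
      show "\<forall>x\<in>set (map ?g \<beta>1). \<forall>y\<in>set (map ?g \<beta>2). x < y"
        unfolding setg1 setg2 by auto
    qed
    moreover have "sorted (map ?g (stack_sort \<beta>))"
    proof (rule sorted_map_mono)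
      show "sorted (stack_sort \<beta>)" using B by (simp add: two_sortable_def \<beta>_def)
      show "mono_on (set (stack_sort \<beta>)) ?g"
        using ms by (simp add: strict_mono_on_imp_mono_on)
    qed
    ultimately have "sorted (stack_sort (map ?g \<beta>1) @ stack_sort (map ?g \<beta>2))" by metis
    then show ?thesis unfolding sorted_append by blast
  qed
  moreover have "\<forall>x\<in>set \<alpha>. x < a" "\<forall>x\<in>set (map ?g \<beta>1). a \<le> x \<and> x < a + c"
    "\<forall>x\<in>set (map ?g \<beta>2). a + c < x \<and> x \<le> n"
    unfolding set\<alpha> setg1 setg2 n by auto
  ultimately have "sorted (stack_sort (stack_sort ?\<pi>))"
    using cb n by (fastforce simp: sorted_append simp del: set_map)
  then show "?\<pi> \<in> two_sortable (Suc n)"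
    using set\<pi> d\<pi> by (simp add: two_sortable_def)
  let ?E = "{y \<in> cuts \<beta>. c \<le> y}"
  \<comment> \<open>Three disjoint families of cuts: those of s(A) other than its end
    \<open>a\<close>, those of s(B) from \<open>c\<close> on shifted by \<open>a\<close>, and the
    new end. For \<open>c = 0\<close> the position \<open>a\<close> comes back in the second
    family.\<close>
  let ?U = "(cuts (stack_sort A) - {a}) \<union> ((+) a ` ?E \<union> {Suc n})"
  have len: "length (stack_sort ?\<pi>) = Suc n"
    using length_two_sortable[OF \<open>?\<pi> \<in> two_sortable (Suc n)\<close>] by simp
  have "?U \<subseteq> cuts (stack_sort ?\<pi>)"
  proof (intro Un_least subsetI)
    fix i assume i: "i \<in> cuts (stack_sort A) - {a}"
    then have "i \<le> length (stack_sort A)" "i \<noteq> a" by (simp_all add: cuts_def)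
    then have "i \<le> length \<alpha>" using lenA len\<alpha> by simp
    moreover from this have "set (take i \<alpha>) = {1..i}" using i by (simp add: cuts_def sA)
    ultimately show "i \<in> cuts (stack_sort ?\<pi>)" by (simp add: cuts_def s\<pi>)
  next
    fix x assume "x \<in> (+) a ` ?E"
    then obtain i where x: "x = a + i" and i: "i \<le> b" "set (take i \<beta>) = {1..i}" "c \<le> i"
      by (auto simp: cuts_def len\<beta>)
    have "take x (stack_sort ?\<pi>) = \<alpha> @ (a + c) # map ?g (take i \<beta>)"
      using i(1) a len\<beta> by (simp add: s\<pi> x len\<alpha> \<beta> take_map flip: map_append)
    then have "set (take x (stack_sort ?\<pi>)) = {1..<a} \<union> {a + c} \<union> ?g ` {1..i}"
      using i(2) set\<alpha> by auto
    also have "\<dots> = {1..a + i}"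
      unfolding lift_gap_image[OF a i(3)] using a i(3) by auto
    finally have "set (take x (stack_sort ?\<pi>)) = {1..x}" unfolding x .
    moreover have "x \<le> length (stack_sort ?\<pi>)" unfolding len using i(1) n x by simp
    ultimately show "x \<in> cuts (stack_sort ?\<pi>)" unfolding cuts_def by blast
  next
    fix x assume "x \<in> {Suc n}"
    then show "x \<in> cuts (stack_sort ?\<pi>)" using len set\<pi> by (simp add: cuts_def)
  qed
  then have "card ?U \<le> card (cuts (stack_sort ?\<pi>))" by (intro card_mono) simp_all
  moreover have "card ?U = (card (cuts (stack_sort A)) - 1) + (card ?E + 1)"
  proof -
    have inj: "card ((+) a ` ?E) = card ?E" by (intro card_image) simp
    have "Suc n \<notin> (+) a ` ?E" by (auto simp: cuts_def len\<beta> n)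
    then have "card ((+) a ` ?E \<union> {Suc n}) = card ?E + 1" by (simp add: inj)
    moreover have "a \<in> cuts (stack_sort A)" using lenA setA by (simp add: cuts_def)
    then have "card (cuts (stack_sort A) - {a}) = card (cuts (stack_sort A)) - 1" by simp
    moreover have "(cuts (stack_sort A) - {a}) \<inter> ((+) a ` ?E \<union> {Suc n}) = {}"
      by (auto simp: cuts_def lenA n)
    ultimately show ?thesis by (subst card_Un_disjoint) auto
  qed
  ultimately show "comps A + card {y \<in> cuts (stack_sort B). c \<le> y} \<le> comps ?\<pi>"
    by (simp add: card_cuts_stack_sort \<beta>_def)
qed

text \<open>The entry \<open>Suc n\<close> marks the boundary, the length of the left part gives
  \<open>a\<close>, its one value outside 1..a-1 gives \<open>c\<close>, and the relabellings can
  then be undone.\<close>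

lemma glue_inj:
  assumes A: "A \<in> two_sortable a" "A' \<in> two_sortable a'" and a: "1 \<le> a" "1 \<le> a'" "a + b = n" "a' + b' = n"
    and B: "B \<in> two_sortable b" "B' \<in> two_sortable b'"
    and c: "c \<in> cuts (stack_sort B)" "c' \<in> cuts (stack_sort B')"
    and eq: "glue n c A B = glue n c' A' B'"
  shows "a = a' \<and> A = A' \<and> B = B' \<and> c = c'"
proof -
  have S: "set A = {1..a}" "set A' = {1..a'}" "set B = {1..b}" "set B' = {1..b'}"
    using A B by (auto simp: two_sortable_def)
  have len: "length A = a" "length A' = a'" "length B = b" "length B' = b'"
    using A B by (auto dest: length_two_sortable)
  have cb: "c \<le> b" "c' \<le> b'" using c len by (auto simp: cuts_def)
  have fA: "lift_max a c ` set A = {1..<a} \<union> {a + c}" "lift_max a' c' ` set A' = {1..<a'} \<union> {a' + c'}"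
    using lift_max_image a S by auto
  have gB: "lift_gap a c ` set B = {a..<a + c} \<union> {a + Suc c..a + b}"
    "lift_gap a' c' ` set B' = {a'..<a' + c'} \<union> {a' + Suc c'..a' + b'}"
    using lift_gap_image a cb S by auto
  have "Suc n \<notin> set (map (lift_max a c) A)" "Suc n \<notin> set (map (lift_gap a c) B)"
    using fA(1) gB(1) a cb by auto
  then have maps: "map (lift_max a c) A = map (lift_max a' c') A'" "map (lift_gap a c) B = map (lift_gap a' c') B'"
    using eq by (simp_all add: glue_def len append_Cons_eq_iff)
  then have aa: "a = a'" using len by (metis length_map)
  have "{1..<a} \<union> {a + c} = {1..<a} \<union> {a + c'}"
    using arg_cong[OF maps(1), of set] fA aa by simp
  then have cc: "c = c'" by (metis Un_iff add_left_cancel atLeastLessThan_iff le_add1 not_less singleton_iff)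
  have "A = A'"
    using maps(1) strict_mono_on_imp_inj_on[OF strict_mono_lift_max[of a c]] S aa cc
    by (metis inj_on_map_eq_map sup.idem)
  moreover have "B = B'"
    using maps(2) strict_mono_on_imp_inj_on[OF strict_mono_lift_gap[OF a(1), of b c]] S aa cc a
    by (metis add_left_cancel inj_on_map_eq_map sup.idem)
  ultimately show ?thesis using aa cc by simp
qed

section \<open>The recurrence\<close>

text \<open>The coefficient of $x^n v^k u^j$: since $z = 1 + u$, the power $z^c$ contributes \<^term>\<open>c choose j\<close>.\<close>

definition weight :: "nat \<Rightarrow> nat \<Rightarrow> nat \<Rightarrow> nat" where
  "weight n k j = (\<Sum>\<pi>\<in>two_sortable n. card (forests \<pi> k) * (comps \<pi> choose j))"

lemma weight_0: "weight 0 k j = (if k = 0 \<and> j = 0 then 1 else 0)"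
  by (cases j) (simp_all add: weight_def two_sortable_0 card_forests_Nil comps_Nil)

text \<open>A one-word forest of a permutation in \<open>two_sortable n\<close> is a preimage under
  s, hence 3-stack-sortable; at \<open>j = 0\<close> each counts once.\<close>

lemma weight_le_W3: "weight n 1 0 \<le> W3 n"
proof -
  let ?S = "SIGMA \<pi>:two_sortable n. forests \<pi> 1"
  let ?f = "\<lambda>(\<pi> :: nat list, \<rho>s :: nat list list). hd \<rho>s"
  have single: "\<exists>\<rho>. \<rho>s = [\<rho>] \<and> stack_sort \<rho> = \<pi>" if "\<rho>s \<in> forests \<pi> 1" for \<rho>s \<pi>
    using that by (auto simp: forests_def length_Suc_conv)
  have "weight n 1 0 = card ?S" by (simp add: weight_def)
  also have "\<dots> \<le> W3 n"
    unfolding W3_def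
  proof (rule card_inj_on_le)
    show "inj_on ?f ?S"
    proof (rule inj_onI)
      fix p q assume pq: "p \<in> ?S" "q \<in> ?S" "?f p = ?f q"
      obtain \<pi> \<rho> where "p = (\<pi>, [\<rho>])" "stack_sort \<rho> = \<pi>" using pq(1) single by blast
      moreover obtain \<pi>' \<rho>' where "q = (\<pi>', [\<rho>'])" "stack_sort \<rho>' = \<pi>'" using pq(2) single by blast
      ultimately show "p = q" using pq(3) by simp
    qed
    show "?f ` ?S \<subseteq> {p \<in> permutations_of_set {1..n}. three_stack_sortable p}"
    proof (rule image_subsetI)
      fix p assume "p \<in> ?S"
      then obtain \<pi> \<rho> where p: "p = (\<pi>, [\<rho>])" "\<pi> \<in> two_sortable n" "stack_sort \<rho> = \<pi>"
        using single by blast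
      have d: "distinct \<pi>" and s: "set \<pi> = {1..n}" and so: "sorted (stack_sort (stack_sort \<pi>))"
        using p(2) by (simp_all add: two_sortable_def)
      have "\<rho> \<in> permutations_of_set {1..n}"
        using d s unfolding p(3)[symmetric] by (simp add: permutations_of_set_def)
      moreover have "three_stack_sortable \<rho>"
        using d so by (simp add: three_stack_sortable_def p(3) strict_sorted_iff)
      ultimately show "?f p \<in> {p \<in> permutations_of_set {1..n}. three_stack_sortable p}"
        by (simp add: p(1))
    qed
  qed simp
  finally show ?thesis .
qed

text \<open>
  The root \<^term>\<open>m\<close> of the last tree of a forest with postorder \<^term>\<open>A @ [m]\<close> has 0, 1 or 2 nonempty
  subtrees, which are the last trees of a forest with postorder \<^term>\<open>A\<close>; a single subtree can
  be on either side.
\<close>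

definition root_count :: "nat list \<Rightarrow> nat \<Rightarrow> nat" where
  "root_count A i = card (forests A i) + 2 * card (forests A (Suc i)) + card (forests A (Suc (Suc i)))"

text \<open>Cut the forest right after the word whose image ends in \<open>m\<close>. The left piece
  has at least one word, hence the shift from \<open>i\<close> to \<open>Suc i\<close>.\<close>

lemma card_forests_root:
  assumes "\<forall>x\<in>set A. x < m"
  shows "(\<Sum>i\<le>k. root_count A i * card (forests B (k - i))) \<le> card (forests (A @ m # B) (Suc k))"
proof -
  have "(\<Sum>i\<le>k. root_count A i * card (forests B (k - i)))
      \<le> (\<Sum>i\<le>k. card (forests (A @ [m]) (Suc i)) * card (forests B (k - i)))"
    unfolding root_count_def by (intro sum_mono mult_le_mono1 card_forests_snoc_max assms)
  also have "\<dots> \<le> (\<Sum>i\<le>Suc k. card (forests (A @ [m]) i) * card (forests B (Suc k - i)))"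
    by (simp only: sum.atMost_Suc_shift diff_Suc_Suc)
  also have "\<dots> \<le> card (forests ((A @ [m]) @ B) (Suc k))" by (rule card_forests_append)
  finally show ?thesis by simp
qed

text \<open>By \<open>sum_rank\<close> the exponents are m + r for r = 1, ...,
  \<open>comps B\<close> + 1. In z = 1 + u the powers add up to z^(m+1) (z^(comps B + 1) - 1) / u;
  its coefficient of u^j is found by Vandermonde and the hockey-stick identity.\<close>

lemma sum_cuts_choose:
  "(\<Sum>c\<in>cuts (stack_sort B). (m + card {y \<in> cuts (stack_sort B). c \<le> y}) choose j)
    = (\<Sum>l\<le>j. (Suc m choose l) * (Suc (comps B) choose Suc (j - l)))"
proof -
  have "(\<Sum>c\<in>cuts (stack_sort B). (m + card {y \<in> cuts (stack_sort B). c \<le> y}) choose j)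
      = (\<Sum>i<Suc (comps B). (m + Suc i) choose j)"
    using sum_rank[of "cuts (stack_sort B)" "\<lambda>r. (m + r) choose j"] by (simp add: card_cuts_stack_sort)
  also have "\<dots> = (\<Sum>i\<le>comps B. \<Sum>l\<le>j. (Suc m choose l) * (i choose (j - l)))"
    by (simp only: vandermonde lessThan_Suc_atMost) simp
  also have "\<dots> = (\<Sum>l\<le>j. \<Sum>i\<le>comps B. (Suc m choose l) * (i choose (j - l)))"
    by (rule sum.swap)
  also have "\<dots> = (\<Sum>l\<le>j. (Suc m choose l) * (Suc (comps B) choose Suc (j - l)))"
    by (simp only: sum_distrib_left[symmetric] sum_choose_upper)
  finally show ?thesis .
qed

text \<open>Moving the sums over \<open>i\<close> and \<open>l\<close> outside decouples the two
  factors, so that a sum over pairs of permutations becomes a convolution of weights.\<close>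

lemma sum_product_separate:
  fixes f u :: "'b \<Rightarrow> 'i \<Rightarrow> 'a :: comm_semiring_0"
  shows "(\<Sum>a\<in>A. \<Sum>b\<in>B. (\<Sum>i\<in>I. f a i * g b i) * (\<Sum>l\<in>L. u a l * v b l))
       = (\<Sum>i\<in>I. \<Sum>l\<in>L. (\<Sum>a\<in>A. f a i * u a l) * (\<Sum>b\<in>B. g b i * v b l))"
proof -
  have "(\<Sum>a\<in>A. \<Sum>b\<in>B. (\<Sum>i\<in>I. f a i * g b i) * (\<Sum>l\<in>L. u a l * v b l))
      = (\<Sum>a\<in>A. \<Sum>b\<in>B. \<Sum>i\<in>I. \<Sum>l\<in>L. (f a i * u a l) * (g b i * v b l))"
    by (simp add: sum_product mult_ac)
  also have "\<dots> = (\<Sum>a\<in>A. \<Sum>i\<in>I. \<Sum>l\<in>L. \<Sum>b\<in>B. (f a i * u a l) * (g b i * v b l))"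
    by (subst sum.swap) (subst (2) sum.swap, rule refl)
  also have "\<dots> = (\<Sum>i\<in>I. \<Sum>l\<in>L. \<Sum>a\<in>A. \<Sum>b\<in>B. (f a i * u a l) * (g b i * v b l))"
    by (subst sum.swap) (subst (2) sum.swap, rule refl)
  also have "\<dots> = (\<Sum>i\<in>I. \<Sum>l\<in>L. (\<Sum>a\<in>A. f a i * u a l) * (\<Sum>b\<in>B. g b i * v b l))"
    by (simp add: sum_product)
  finally show ?thesis .
qed

definition shift :: "(nat \<Rightarrow> 'a) \<Rightarrow> nat \<Rightarrow> 'a :: zero" where
  "shift f j = (case j of 0 \<Rightarrow> 0 | Suc i \<Rightarrow> f i)"

lemma shift_simps [simp]: "shift f 0 = 0" "shift f (Suc i) = f i"
  by (simp_all add: shift_def)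

text \<open>
  On coefficients, \<open>op_M\<close> is multiplication by $z(1+v)^2/v$ and \<open>op_T\<close> sends $H$ to
  $H + (H - [u^0]H)/u$. Both \<open>op_N\<close> and \<open>op_M\<close> are meaningful only for $k \ge 1$.
\<close>

definition op_N :: "(nat \<Rightarrow> nat \<Rightarrow> 'a) \<Rightarrow> nat \<Rightarrow> nat \<Rightarrow> 'a :: comm_semiring_1" where
  "op_N h k j = h (k - 1) j + 2 * h k j + h (k + 1) j"

definition op_M :: "(nat \<Rightarrow> nat \<Rightarrow> 'a) \<Rightarrow> nat \<Rightarrow> nat \<Rightarrow> 'a :: comm_semiring_1" where
  "op_M h k j = op_N h k j + shift (op_N h k) j"

definition op_T :: "(nat \<Rightarrow> nat \<Rightarrow> 'a) \<Rightarrow> nat \<Rightarrow> nat \<Rightarrow> 'a :: comm_semiring_1" where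
  "op_T h k j = h k j + h k (Suc j)"

text \<open>Pascal's rule for \<open>Suc (comps A)\<close> supplies the factor z; the index is
  \<open>Suc k\<close> because \<open>root_count A k\<close> is centred at \<open>k + 1\<close>
  words.\<close>

lemma op_M_weight:
  "(\<Sum>A\<in>two_sortable n. root_count A k * (Suc (comps A) choose j)) = op_M (weight n) (Suc k) j"
  by (cases j)
    (simp_all add: op_M_def op_N_def weight_def root_count_def sum.distrib sum_distrib_left algebra_simps)

lemma op_T_weight:
  "(\<Sum>B\<in>two_sortable n. card (forests B k) * (Suc (comps B) choose Suc j)) = op_T (weight n) k j"
  by (simp add: op_T_def weight_def sum.distrib algebra_simps)

text \<open>Permutations of size n + 1 arise by putting the maximum first or by gluing with 1 \<le>
  a \<le> n. The two families are disjoint and gluing is injective, so their contributions add up to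
  a lower bound.\<close>

lemma weight_Suc_ge:
  "weight n k j + shift (weight n k) j +
    (\<Sum>a=1..n. \<Sum>i\<le>k. \<Sum>l\<le>j. op_M (weight a) (Suc i) l * op_T (weight (n - a)) (k - i) (j - l))
   \<le> weight (Suc n) (Suc k) j"
proof -
  define w where "w \<pi> = card (forests \<pi> (Suc k)) * (comps \<pi> choose j)" for \<pi>
  let ?S = "SIGMA a:{1..n}. SIGMA A:two_sortable a. SIGMA B:two_sortable (n - a). cuts (stack_sort B)"
  let ?g = "\<lambda>(a :: nat, A, B, c). glue n c A B"
  let ?I1 = "(#) (Suc n) ` two_sortable n" and ?I2 = "?g ` ?S"
  have sub1: "?I1 \<subseteq> two_sortable (Suc n)" using Cons_max_two_sortable(1) by blast
  have sub2: "?I2 \<subseteq> two_sortable (Suc n)"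
  proof (rule image_subsetI)
    fix p assume "p \<in> ?S"
    then show "?g p \<in> two_sortable (Suc n)" by (auto intro!: glue_two_sortable(1))
  qed
  \<comment> \<open>A glued word begins with an entry of the relabelled \<open>A\<close>, which is
    at most \<open>n\<close>.\<close>
  have disj: "?I1 \<inter> ?I2 = {}"
  proof -
    have no: False if "a \<in> {1..n}" "A \<in> two_sortable a" "B \<in> two_sortable (n - a)" "c \<in> cuts (stack_sort B)"
      "Suc n # C = glue n c A B" for a A B c C
    proof -
      have A: "set A = {1..a}" "length A = a" using that(2) length_two_sortable by (auto simp: two_sortable_def)
      have "c \<le> n - a" using that(3,4) length_two_sortable[OF that(3)] by (simp add: cuts_def)
      have "A \<noteq> []" using A(2) that(1) by auto
      then obtain x A' where xA: "A = x # A'" by (cases A) auto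
      have "Suc n = lift_max a c x" using that(5) by (simp add: glue_def xA A(2)[symmetric])
      moreover have "x \<in> {1..a}" using A xA by auto
      ultimately show False using \<open>c \<le> n - a\<close> that(1) by (auto simp: lift_max_def split: if_splits)
    qed
    show ?thesis
    proof (rule equals0I)
      fix z assume z: "z \<in> ?I1 \<inter> ?I2"
      then obtain C where C: "z = Suc n # C" by auto
      obtain a A B c where "a \<in> {1..n}" "A \<in> two_sortable a" "B \<in> two_sortable (n - a)"
        "c \<in> cuts (stack_sort B)" "z = glue n c A B" using z by auto
      with C no show False by blast
    qed
  qed
  have inj: "inj_on ?g ?S"
  proof (rule inj_onI)
    fix p q assume pq: "p \<in> ?S" "q \<in> ?S" "?g p = ?g q"
    obtain a A B c a' A' B' c' where "p = (a, A, B, c)" "q = (a', A', B', c')"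
      by (cases p, cases q) auto
    with pq show "p = q" using glue_inj[of A a A' a' "n - a" n "n - a'" B B' c c'] by auto
  qed
  have "sum w ?I1 + sum w ?I2 = sum w (?I1 \<union> ?I2)"
    by (rule sum.union_disjoint[symmetric]) (use sub1 sub2 disj finite_subset[OF _ finite_two_sortable] in auto)
  also have "\<dots> \<le> sum w (two_sortable (Suc n))"
    using sub1 sub2 by (intro sum_mono2) auto
  also have "\<dots> = weight (Suc n) (Suc k) j" by (simp add: weight_def w_def)
  finally have *: "sum w ?I1 + sum w ?I2 \<le> weight (Suc n) (Suc k) j" .
  have "weight n k j + shift (weight n k) j = (\<Sum>B\<in>two_sortable n. card (forests B k) * (Suc (comps B) choose j))"
    by (cases j) (simp_all add: weight_def sum.distrib algebra_simps)
  also have "\<dots> \<le> (\<Sum>B\<in>two_sortable n. w (Suc n # B))"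
  proof (rule sum_mono)
    fix B assume B: "B \<in> two_sortable n"
    \<comment> \<open>The empty word has only the empty forest, so \<open>i = 0\<close> is the only
      nonzero term.\<close>
    have "(\<Sum>i\<le>k. root_count [] i * card (forests B (k - i))) \<ge> (\<Sum>i\<in>{0}. root_count [] i * card (forests B (k - i)))"
      by (rule sum_mono2) auto
    then have "card (forests B k) \<le> card (forests ([] @ Suc n # B) (Suc k))"
      using card_forests_root[of "[]" "Suc n" B k] by (simp add: root_count_def card_forests_Nil)
    then show "card (forests B k) * (Suc (comps B) choose j) \<le> w (Suc n # B)"
      unfolding w_def using Cons_max_two_sortable(2)[OF B] by (intro mult_le_mono binomial_right_mono) auto
  qed
  also have "\<dots> = sum w ?I1" by (subst sum.reindex) auto
  finally have 1: "weight n k j + shift (weight n k) j \<le> sum w ?I1" .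
  have "(\<Sum>i\<le>k. \<Sum>l\<le>j. op_M (weight a) (Suc i) l * op_T (weight (n - a)) (k - i) (j - l))
      \<le> (\<Sum>A\<in>two_sortable a. \<Sum>B\<in>two_sortable (n - a). \<Sum>c\<in>cuts (stack_sort B). w (glue n c A B))"
    if a: "a \<in> {1..n}" for a
  proof -
    have "(\<Sum>i\<le>k. \<Sum>l\<le>j. op_M (weight a) (Suc i) l * op_T (weight (n - a)) (k - i) (j - l))
      = (\<Sum>A\<in>two_sortable a. \<Sum>B\<in>two_sortable (n - a).
          (\<Sum>i\<le>k. root_count A i * card (forests B (k - i))) *
          (\<Sum>l\<le>j. (Suc (comps A) choose l) * (Suc (comps B) choose Suc (j - l))))"
      unfolding sum_product_separate op_M_weight op_T_weight ..
    also have "\<dots> \<le> (\<Sum>A\<in>two_sortable a. \<Sum>B\<in>two_sortable (n - a). \<Sum>c\<in>cuts (stack_sort B). w (glue n c A B))"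
    proof (intro sum_mono)
      fix A B assume A: "A \<in> two_sortable a" and B: "B \<in> two_sortable (n - a)"
      have setA: "set A = {1..a}" and lenA: "length A = a"
        using A length_two_sortable by (auto simp: two_sortable_def)
      have setB: "set B = {1..n - a}" and lenB: "length B = n - a"
        using B length_two_sortable by (auto simp: two_sortable_def)
      have "(\<Sum>i\<le>k. root_count A i * card (forests B (k - i))) * ((comps A + card {y \<in> cuts (stack_sort B). c \<le> y}) choose j)
          \<le> w (glue n c A B)" if c: "c \<in> cuts (stack_sort B)" for c
      proof -
        let ?A = "map (lift_max a c) A" and ?B = "map (lift_gap a c) B"
        have cb: "c \<le> n - a" using c lenB by (simp add: cuts_def)
        have mA: "strict_mono_on (set A) (lift_max a c)" and mB: "strict_mono_on (set B) (lift_gap a c)"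
          using strict_mono_lift_max strict_mono_lift_gap a setA setB by auto
        \<comment> \<open>Increasing relabellings do not decrease forest counts, so \<open>A\<close>
          and \<open>B\<close> may be replaced by the parts of the glued word.\<close>
        have "(\<Sum>i\<le>k. root_count A i * card (forests B (k - i)))
            \<le> (\<Sum>i\<le>k. root_count ?A i * card (forests ?B (k - i)))"
          unfolding root_count_def
          by (intro sum_mono mult_le_mono add_le_mono order.refl card_forests_map mA mB)
        also have "\<dots> \<le> card (forests (?A @ Suc n # ?B) (Suc k))"
        proof (rule card_forests_root)
          have "set ?A = {1..<a} \<union> {a + c}" using lift_max_image[of a c] a setA by simp
          then show "\<forall>x\<in>set ?A. x < Suc n" using cb a by auto
        qed
        also have "?A @ Suc n # ?B = glue n c A B" by (simp add: glue_def lenA)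
        finally show ?thesis
          unfolding w_def using glue_two_sortable(2)[OF A _ B c] a
          by (intro mult_le_mono binomial_right_mono) auto
      qed
      then show "(\<Sum>i\<le>k. root_count A i * card (forests B (k - i))) *
          (\<Sum>l\<le>j. (Suc (comps A) choose l) * (Suc (comps B) choose Suc (j - l)))
          \<le> (\<Sum>c\<in>cuts (stack_sort B). w (glue n c A B))"
        unfolding sum_cuts_choose[symmetric] sum_distrib_left by (intro sum_mono)
    qed
    finally show ?thesis .
  qed
  then have "(\<Sum>a=1..n. \<Sum>i\<le>k. \<Sum>l\<le>j. op_M (weight a) (Suc i) l * op_T (weight (n - a)) (k - i) (j - l))
      \<le> (\<Sum>a=1..n. \<Sum>A\<in>two_sortable a. \<Sum>B\<in>two_sortable (n - a). \<Sum>c\<in>cuts (stack_sort B). w (glue n c A B))"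
    by (rule sum_mono)
  also have "\<dots> = (\<Sum>p\<in>?S. w (?g p))"
    by (simp add: sum.Sigma split_def)
  also have "\<dots> = sum w ?I2" using sum.reindex[OF inj, of w] by (simp add: comp_def)
  finally show ?thesis using 1 * by linarith
qed

section \<open>The functional inequality\<close>

text \<open>The terms linear in H: \<open>op_M\<close> comes from the summand 1 in the second
  bracket of the functional equation, the rest is zvH. The case \<open>k = 0\<close> is cut off
  because [v^1]H is subtracted.\<close>

definition op_lin :: "(nat \<Rightarrow> nat \<Rightarrow> 'a) \<Rightarrow> nat \<Rightarrow> nat \<Rightarrow> 'a :: comm_semiring_1" where
  "op_lin p k j = (if k = 0 then 0 else op_M p k j + p (k - 1) j + shift (p (k - 1)) j)"

text \<open>The range of \<open>i\<close> starts at 1 because subtracting [v^1]H removes the v^0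
  term of the first factor, and stops before \<open>k\<close> because H has no v^0 term.\<close>

definition op_bil :: "(nat \<Rightarrow> nat \<Rightarrow> 'a) \<Rightarrow> (nat \<Rightarrow> nat \<Rightarrow> 'a) \<Rightarrow> nat \<Rightarrow> nat \<Rightarrow> 'a :: comm_semiring_1" where
  "op_bil p q k j = (\<Sum>i=1..<k. \<Sum>l\<le>j. op_M p i l * op_T q (k - i) (j - l))"

definition base :: "nat \<Rightarrow> nat \<Rightarrow> 'a :: comm_semiring_1" where
  "base k j = (if k = 1 \<and> j \<le> 1 then 1 else 0)"

definition Phi :: "real \<Rightarrow> (nat \<Rightarrow> nat \<Rightarrow> real) \<Rightarrow> nat \<Rightarrow> nat \<Rightarrow> real" where
  "Phi x p k j = x * (base k j + op_lin p k j + op_bil p p k j)"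

definition partial_gf :: "real \<Rightarrow> nat \<Rightarrow> nat \<Rightarrow> nat \<Rightarrow> real" where
  "partial_gf x N k j = (\<Sum>n=1..N. real (weight n k j) * x ^ n)"

lemma op_M_partial_gf: "op_M (partial_gf x N) k j = (\<Sum>n=1..N. real (op_M (weight n) k j) * x ^ n)"
  by (cases j) (simp_all add: op_M_def op_N_def partial_gf_def sum.distrib sum_distrib_left algebra_simps)

lemma op_T_partial_gf: "op_T (partial_gf x N) k j = (\<Sum>n=1..N. real (op_T (weight n) k j) * x ^ n)"
  by (simp add: op_T_def partial_gf_def sum.distrib algebra_simps)

lemma op_T_weight_0: "op_T (weight 0) k j = (if k = 0 \<and> j = 0 then 1 else 0)"
  by (simp add: op_T_def weight_0)

lemma sum_products_swap:
  fixes F G :: "'a \<Rightarrow> 'i \<Rightarrow> 'c :: comm_semiring_0"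
  shows "(\<Sum>i\<in>I. (\<Sum>a\<in>A. F a i) * (\<Sum>b\<in>B. G b i)) = (\<Sum>a\<in>A. \<Sum>b\<in>B. \<Sum>i\<in>I. F a i * G b i)"
proof -
  have "(\<Sum>i\<in>I. (\<Sum>a\<in>A. F a i) * (\<Sum>b\<in>B. G b i)) = (\<Sum>i\<in>I. \<Sum>a\<in>A. \<Sum>b\<in>B. F a i * G b i)"
    by (simp add: sum_product)
  also have "\<dots> = (\<Sum>a\<in>A. \<Sum>i\<in>I. \<Sum>b\<in>B. F a i * G b i)" by (rule sum.swap)
  also have "\<dots> = (\<Sum>a\<in>A. \<Sum>b\<in>B. \<Sum>i\<in>I. F a i * G b i)"
    by (intro sum.cong refl sum.swap)
  finally show ?thesis .
qed

text \<open>Pairs with both entries at most \<open>N\<close> have sum at most \<open>2 * N\<close>;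
  the further terms on the right are nonnegative.\<close>

lemma sum_convolution_ge:
  fixes D :: "nat \<Rightarrow> nat \<Rightarrow> real"
  assumes "\<And>a b. 0 \<le> D a b"
  shows "(\<Sum>a=1..N. \<Sum>b\<le>N. D a b) \<le> (\<Sum>n\<le>2*N. \<Sum>a=1..n. D a (n - a))"
proof -
  let ?h = "\<lambda>(a, b). (a + b, a) :: nat \<times> nat"
  have "(\<Sum>a=1..N. \<Sum>b\<le>N. D a b) = (\<Sum>(a, b)\<in>{1..N} \<times> {..N}. D a b)"
    by (simp add: sum.cartesian_product)
  also have "\<dots> = (\<Sum>p\<in>?h ` ({1..N} \<times> {..N}). D (snd p) (fst p - snd p))"
    by (subst sum.reindex) (auto intro!: inj_onI simp: split_def)
  also have "\<dots> \<le> (\<Sum>p\<in>(SIGMA n:{..2*N}. {1..n}). D (snd p) (fst p - snd p))"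
    by (intro sum_mono2) (auto simp: assms)
  also have "\<dots> = (\<Sum>n\<le>2*N. \<Sum>a=1..n. D a (n - a))"
    by (simp add: sum.Sigma split_def)
  finally show ?thesis .
qed

text \<open>Coefficientwise this is \<open>weight_Suc_ge\<close>: a product of two sums up to
  \<open>N\<close> reaches total size \<open>2 * N\<close>, and the factor \<open>x\<close> accounts
  for the new maximum.\<close>

lemma partial_gf_step:
  assumes x: "0 \<le> x"
  shows "Phi x (partial_gf x N) k j \<le> partial_gf x (2 * N + 1) k j"
proof (cases k)
  case 0
  then show ?thesis
    using x by (simp add: Phi_def base_def op_lin_def op_bil_def partial_gf_def sum_nonneg)
next
  case (Suc k')
  \<comment> \<open>\<open>D a 0\<close> dominates the linear term \<open>op_M\<close>, which comes
    from an empty \<open>B\<close>; \<open>D a b\<close> with \<open>b \<ge> 1\<close> dominates the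
    bilinear part.\<close>
  define D where "D a b = (\<Sum>i\<le>k'. \<Sum>l\<le>j. real (op_M (weight a) (Suc i) l) * real (op_T (weight b) (k' - i) (j - l)))" for a b
  have D0: "D a b \<ge> 0" for a b unfolding D_def by (intro sum_nonneg) auto
  \<comment> \<open>The term of size 0, absent from \<open>partial_gf\<close>, supplies half of the
    constant term \<open>base\<close>; the shifted version supplies the other half.\<close>
  have prefix: "(if k' = 0 \<and> i = 0 then 1 else 0) + partial_gf x N k' i \<le> (\<Sum>n\<le>2*N. real (weight n k' i) * x ^ n)" for i
  proof -
    have "(if k' = 0 \<and> i = 0 then 1 else 0) + partial_gf x N k' i = (\<Sum>n\<in>insert 0 {1..N}. real (weight n k' i) * x ^ n)"
      by (simp add: partial_gf_def weight_0)
    also have "\<dots> \<le> (\<Sum>n\<le>2*N. real (weight n k' i) * x ^ n)"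
      by (rule sum_mono2) (auto simp: x)
    finally show ?thesis .
  qed
  have prefix': "(if k' = 0 \<and> j = 1 then 1 else 0) + shift (partial_gf x N k') j
      \<le> (\<Sum>n\<le>2*N. real (shift (weight n k') j) * x ^ n)"
  proof (cases j)
    case (Suc i)
    then show ?thesis using prefix[of i] by simp
  qed simp
  have D_single: "real (op_M (weight a) (Suc k') j) \<le> D a 0" for a
  proof -
    have "real (op_M (weight a) (Suc k') j) = (\<Sum>l\<in>{j}. real (op_M (weight a) (Suc k') l) * real (op_T (weight 0) (k' - k') (j - l)))"
      by (simp add: op_T_weight_0)
    also have "\<dots> \<le> (\<Sum>l\<le>j. real (op_M (weight a) (Suc k') l) * real (op_T (weight 0) (k' - k') (j - l)))"
      by (rule sum_mono2) auto
    also have "\<dots> = (\<Sum>i\<in>{k'}. \<Sum>l\<le>j. real (op_M (weight a) (Suc i) l) * real (op_T (weight 0) (k' - i) (j - l)))"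
      by simp
    also have "\<dots> \<le> D a 0"
      unfolding D_def by (rule sum_mono2) (auto intro: sum_nonneg)
    finally show ?thesis .
  qed
  have D_part: "(\<Sum>i=1..<k. \<Sum>l\<le>j. real (op_M (weight a) i l) * real (op_T (weight b) (k - i) (j - l))) \<le> D a b" for a b
  proof -
    have "(\<Sum>i=1..<k. \<Sum>l\<le>j. real (op_M (weight a) i l) * real (op_T (weight b) (k - i) (j - l)))
        = (\<Sum>i=0..<k'. \<Sum>l\<le>j. real (op_M (weight a) (Suc i) l) * real (op_T (weight b) (k' - i) (j - l)))"
      unfolding Suc One_nat_def sum.shift_bounds_Suc_ivl by simp
    also have "\<dots> \<le> D a b"
      unfolding D_def by (rule sum_mono2) (auto intro: sum_nonneg)
    finally show ?thesis .
  qed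
  have bil: "op_bil (partial_gf x N) (partial_gf x N) k j \<le> (\<Sum>a=1..N. \<Sum>b=1..N. D a b * x ^ (a + b))"
  proof -
    have "op_bil (partial_gf x N) (partial_gf x N) k j =
      (\<Sum>p\<in>{1..<k} \<times> {..j}. (\<Sum>a=1..N. real (op_M (weight a) (fst p) (snd p)) * x ^ a) *
        (\<Sum>b=1..N. real (op_T (weight b) (k - fst p) (j - snd p)) * x ^ b))"
      unfolding op_bil_def op_M_partial_gf op_T_partial_gf by (simp add: sum.cartesian_product split_def)
    also have "\<dots> = (\<Sum>a=1..N. \<Sum>b=1..N. \<Sum>p\<in>{1..<k} \<times> {..j}.
        real (op_M (weight a) (fst p) (snd p)) * x ^ a * (real (op_T (weight b) (k - fst p) (j - snd p)) * x ^ b))"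
      by (rule sum_products_swap)
    also have "\<dots> = (\<Sum>a=1..N. \<Sum>b=1..N. (\<Sum>i=1..<k. \<Sum>l\<le>j. real (op_M (weight a) i l) * real (op_T (weight b) (k - i) (j - l))) * x ^ (a + b))"
      by (simp add: sum.cartesian_product split_def sum_distrib_left sum_distrib_right power_add mult_ac)
    also have "\<dots> \<le> (\<Sum>a=1..N. \<Sum>b=1..N. D a b * x ^ (a + b))"
      using x D_part by (intro sum_mono mult_right_mono) auto
    finally show ?thesis .
  qed
  have conv: "op_M (partial_gf x N) k j + op_bil (partial_gf x N) (partial_gf x N) k j
      \<le> (\<Sum>n\<le>2*N. \<Sum>a=1..n. D a (n - a) * x ^ n)"
  proof -
    have "op_M (partial_gf x N) k j \<le> (\<Sum>a=1..N. D a 0 * x ^ a)"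
      unfolding op_M_partial_gf Suc using D_single x by (intro sum_mono mult_right_mono) auto
    then have "op_M (partial_gf x N) k j + op_bil (partial_gf x N) (partial_gf x N) k j
        \<le> (\<Sum>a=1..N. D a 0 * x ^ a) + (\<Sum>a=1..N. \<Sum>b=1..N. D a b * x ^ (a + b))"
      using bil by linarith
    also have "\<dots> = (\<Sum>a=1..N. \<Sum>b\<in>insert 0 {1..N}. D a b * x ^ (a + b))"
      by (simp add: sum.distrib)
    also have "insert 0 {1..N} = {..N}" by auto
    also have "(\<Sum>a=1..N. \<Sum>b\<le>N. D a b * x ^ (a + b)) \<le> (\<Sum>n\<le>2*N. \<Sum>a=1..n. D a (n - a) * x ^ (a + (n - a)))"
      by (rule sum_convolution_ge) (use D0 x in auto)
    also have "\<dots> = (\<Sum>n\<le>2*N. \<Sum>a=1..n. D a (n - a) * x ^ n)"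
      by (intro sum.cong refl) auto
    finally show ?thesis .
  qed
  have rec: "real (weight n k' j) + real (shift (weight n k') j) + (\<Sum>a=1..n. D a (n - a)) \<le> real (weight (Suc n) k j)" for n
    using weight_Suc_ge[of n k' j] unfolding Suc D_def of_nat_le_iff[symmetric, where ?'a = real] by simp
  have "base k j + op_lin (partial_gf x N) k j + op_bil (partial_gf x N) (partial_gf x N) k j
      = ((if k' = 0 \<and> j = 0 then 1 else 0) + partial_gf x N k' j)
        + ((if k' = 0 \<and> j = 1 then 1 else 0) + shift (partial_gf x N k') j)
        + (op_M (partial_gf x N) k j + op_bil (partial_gf x N) (partial_gf x N) k j)"
    by (auto simp: Suc op_lin_def base_def)
  also have "\<dots> \<le> (\<Sum>n\<le>2*N. real (weight n k' j) * x ^ n) + (\<Sum>n\<le>2*N. real (shift (weight n k') j) * x ^ n)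
      + (\<Sum>n\<le>2*N. \<Sum>a=1..n. D a (n - a) * x ^ n)"
    by (intro add_mono prefix prefix' conv)
  also have "\<dots> = (\<Sum>n\<le>2*N. (real (weight n k' j) + real (shift (weight n k') j) + (\<Sum>a=1..n. D a (n - a))) * x ^ n)"
    by (simp only: sum.distrib sum_distrib_right distrib_right)
  also have "\<dots> \<le> (\<Sum>n\<le>2*N. real (weight (Suc n) k j) * x ^ n)"
    using rec x by (intro sum_mono mult_right_mono) auto
  finally have "Phi x (partial_gf x N) k j \<le> x * (\<Sum>n\<le>2*N. real (weight (Suc n) k j) * x ^ n)"
    unfolding Phi_def using x by (intro mult_left_mono) auto
  also have "\<dots> = (\<Sum>n\<le>2*N. real (weight (Suc n) k j) * x ^ Suc n)"
    by (simp add: sum_distrib_left mult_ac)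
  also have "\<dots> = partial_gf x (2 * N + 1) k j"
    unfolding partial_gf_def atMost_atLeast0
    using sum.shift_bounds_cl_Suc_ivl[of "\<lambda>n. real (weight n k j) * x ^ n" 0 "2 * N"] by simp
  finally show ?thesis .
qed

section \<open>Monotonicity and convexity of the functional, and propagation of lower bounds\<close>

lemma op_M_mono:
  fixes p q :: "nat \<Rightarrow> nat \<Rightarrow> real"
  assumes "\<And>k j. p k j \<le> q k j"
  shows "op_M p k j \<le> op_M q k j"
  by (cases j) (auto simp: op_M_def op_N_def intro!: add_mono assms)

lemma op_T_mono:
  fixes p q :: "nat \<Rightarrow> nat \<Rightarrow> real"
  assumes "\<And>k j. p k j \<le> q k j"
  shows "op_T p k j \<le> op_T q k j"
  by (auto simp: op_T_def intro!: add_mono assms)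

lemma op_M_nonneg:
  fixes p :: "nat \<Rightarrow> nat \<Rightarrow> real"
  shows "(\<And>k j. 0 \<le> p k j) \<Longrightarrow> 0 \<le> op_M p k j"
  by (cases j) (auto simp: op_M_def op_N_def)

lemma op_T_nonneg:
  fixes p :: "nat \<Rightarrow> nat \<Rightarrow> real"
  shows "(\<And>k j. 0 \<le> p k j) \<Longrightarrow> 0 \<le> op_T p k j"
  by (auto simp: op_T_def)

lemma op_bil_nonneg:
  fixes p q :: "nat \<Rightarrow> nat \<Rightarrow> real"
  shows "(\<And>k j. 0 \<le> p k j) \<Longrightarrow> (\<And>k j. 0 \<le> q k j) \<Longrightarrow> 0 \<le> op_bil p q k j"
  unfolding op_bil_def by (intro sum_nonneg mult_nonneg_nonneg op_M_nonneg op_T_nonneg)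

lemma op_lin_nonneg:
  fixes p :: "nat \<Rightarrow> nat \<Rightarrow> real"
  shows "(\<And>k j. 0 \<le> p k j) \<Longrightarrow> 0 \<le> op_lin p k j"
  by (cases j) (auto simp: op_lin_def op_M_nonneg)

lemma Phi_mono:
  assumes x: "0 \<le> x" and p: "\<And>k j. 0 \<le> p k j" and pq: "\<And>k j. p k j \<le> q k j"
  shows "Phi x p k j \<le> Phi x q k j"
proof -
  have q: "0 \<le> q k j" for k j using p pq order_trans by blast
  have "op_lin p k j \<le> op_lin q k j"
    by (cases j) (auto simp: op_lin_def intro!: add_mono op_M_mono pq)
  moreover have "op_bil p p k j \<le> op_bil q q k j"
    unfolding op_bil_def
    by (intro sum_mono mult_mono op_M_mono op_T_mono op_M_nonneg op_T_nonneg p q pq)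
  ultimately show ?thesis unfolding Phi_def using x by (intro mult_left_mono) auto
qed

text \<open>Domination by a finite partial sum is required, so convergence at \<open>x\<close> never
  has to be assumed.\<close>

definition reachable :: "real \<Rightarrow> (nat \<Rightarrow> nat \<Rightarrow> real) \<Rightarrow> bool" where
  "reachable x p \<longleftrightarrow> (\<exists>N. \<forall>k j. p k j \<le> partial_gf x N k j)"

lemma reachable_step:
  assumes "0 \<le> x" "reachable x p" "\<And>k j. 0 \<le> p k j" "\<And>k j. q k j \<le> Phi x p k j"
  shows "reachable x q"
proof -
  obtain N where "\<And>k j. p k j \<le> partial_gf x N k j" using assms(2) by (auto simp: reachable_def)
  then have "q k j \<le> partial_gf x (2 * N + 1) k j" for k j
    using assms(4)[of k j] Phi_mono[OF assms(1,3), where q = "partial_gf x N" and k = k and j = j] partial_gf_step[OF assms(1), of N k j]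
    by fastforce
  then show ?thesis unfolding reachable_def by blast
qed

text \<open>The derivative of \<^term>\<open>Phi x\<close> at \<^term>\<open>p\<close> in direction \<^term>\<open>d\<close>.\<close>

definition dPhi :: "real \<Rightarrow> (nat \<Rightarrow> nat \<Rightarrow> real) \<Rightarrow> (nat \<Rightarrow> nat \<Rightarrow> real) \<Rightarrow> nat \<Rightarrow> nat \<Rightarrow> real" where
  "dPhi x p d k j = x * (op_lin d k j + op_bil p d k j + op_bil d p k j)"

lemma op_M_affine:
  fixes p d :: "nat \<Rightarrow> nat \<Rightarrow> real"
  shows "op_M (\<lambda>k j. p k j + t * d k j) k j = op_M p k j + t * op_M d k j"
  by (cases j) (simp_all add: op_M_def op_N_def algebra_simps)

lemma op_T_affine:
  fixes p d :: "nat \<Rightarrow> nat \<Rightarrow> real"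
  shows "op_T (\<lambda>k j. p k j + t * d k j) k j = op_T p k j + t * op_T d k j"
  by (simp add: op_T_def algebra_simps)

text \<open>\<open>Phi x\<close> is quadratic, and its second-order remainder is
  \<open>t\<^sup>2\<close> times a form that is nonnegative at \<open>d\<close>.\<close>

lemma Phi_segment_ge:
  assumes x: "0 \<le> x" and d: "\<And>k j. 0 \<le> d k j"
  shows "Phi x p k j + t * dPhi x p d k j \<le> Phi x (\<lambda>k j. p k j + t * d k j) k j"
proof -
  let ?q = "\<lambda>k j. p k j + t * d k j"
  have lin: "op_lin ?q k j = op_lin p k j + t * op_lin d k j"
    by (cases j) (simp_all add: op_lin_def op_M_affine algebra_simps)
  have bil: "op_bil ?q ?q k j = op_bil p p k j + t * (op_bil p d k j + op_bil d p k j) + t\<^sup>2 * op_bil d d k j"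
    unfolding op_bil_def op_M_affine op_T_affine
    by (simp add: sum.distrib sum_distrib_left algebra_simps power2_eq_square)
  have "Phi x ?q k j = Phi x p k j + t * dPhi x p d k j + x * (t\<^sup>2 * op_bil d d k j)"
    unfolding Phi_def dPhi_def lin bil by (simp add: algebra_simps)
  moreover have "0 \<le> x * (t\<^sup>2 * op_bil d d k j)"
    using x d by (intro mult_nonneg_nonneg op_bil_nonneg) auto
  ultimately show ?thesis by linarith
qed

text \<open>
  By convexity of \<^term>\<open>Phi x\<close>, the inequality at both ends of the segment from \<^term>\<open>p\<close> to \<open>p + d\<close> makes
  every point of it a strict subsolution, so the lower bound moves along the segment in steps of
  \<^term>\<open>e\<close>. The point \<open>p + d\<close> itself need not be close to any iterate.
\<close>

lemma reachable_segment:
  assumes x: "0 \<le> x" and p: "\<And>k j. 0 \<le> p k j" and d: "\<And>k j. 0 \<le> d k j" and e: "0 < e"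
    and r: "reachable x p"
    and start: "\<And>k j. p k j + e * d k j \<le> Phi x p k j"
    and stop: "\<And>k j. p k j + d k j + e * d k j \<le> Phi x p k j + dPhi x p d k j"
  shows "reachable x (\<lambda>k j. p k j + d k j)"
proof -
  have *: "reachable x (\<lambda>k j. p k j + min 1 (real m * e) * d k j)" for m
  proof (induction m)
    case 0
    then show ?case using r by simp
  next
    case (Suc m)
    define t where "t = min 1 (real m * e)"
    have t: "0 \<le> t" "t \<le> 1" "min 1 (real (Suc m) * e) \<le> t + e" using e by (auto simp: t_def algebra_simps)
    show ?case
    proof (rule reachable_step[OF x Suc.IH])
      show "0 \<le> p k j + min 1 (real m * e) * d k j" for k j
        using p d t by (simp add: t_def)
      fix k j
      have "p k j + min 1 (real (Suc m) * e) * d k j \<le> p k j + (t + e) * d k j"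
        using t(3) d by (intro add_left_mono mult_right_mono) auto
      \<comment> \<open>The target is a convex combination of the left-hand sides of
        \<open>start\<close> and \<open>stop\<close>, with weights 1 - t and t.\<close>
      also have "\<dots> = (1 - t) * (p k j + e * d k j) + t * (p k j + d k j + e * d k j)"
        by (simp add: algebra_simps)
      also have "\<dots> \<le> (1 - t) * Phi x p k j + t * (Phi x p k j + dPhi x p d k j)"
        using t by (intro add_mono mult_left_mono start stop) auto
      also have "\<dots> = Phi x p k j + t * dPhi x p d k j" by (simp add: algebra_simps)
      also have "\<dots> \<le> Phi x (\<lambda>k j. p k j + t * d k j) k j" by (rule Phi_segment_ge[OF x d])
      finally show "p k j + min 1 (real (Suc m) * e) * d k j
          \<le> Phi x (\<lambda>k j. p k j + min 1 (real m * e) * d k j) k j" by (simp add: t_def)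
    qed
  qed
  obtain m where "1 < real m * e" using e reals_Archimedean3 by blast
  then show ?thesis using *[of m] by (simp add: min_def)
qed

text \<open>\<open>start\<close> gives a gain of \<open>e\<close> times \<open>d\<close> at
  \<open>p\<close>, and by \<open>expand\<close> the linearisation does not shrink what was gained
  before. Each iterate thus gains as much again, without bound.\<close>

lemma reachable_ray:
  assumes x: "0 \<le> x" and p: "\<And>k j. 0 \<le> p k j" and d: "\<And>k j. 0 \<le> d k j" and e: "0 < e"
    and r: "reachable x p"
    and start: "\<And>k j. p k j + e * d k j \<le> Phi x p k j"
    and expand: "\<And>k j. d k j \<le> dPhi x p d k j"
  shows "reachable x (\<lambda>k j. p k j + (real m * e) * d k j)"
proof (induction m)
  case 0
  then show ?case using r by simp
next
  case (Suc m)
  show ?case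
  proof (rule reachable_step[OF x Suc.IH])
    show "0 \<le> p k j + real m * e * d k j" for k j using p d e by simp
    fix k j
    have "p k j + real (Suc m) * e * d k j = (p k j + e * d k j) + real m * e * d k j"
      by (simp add: algebra_simps)
    also have "\<dots> \<le> Phi x p k j + real m * e * dPhi x p d k j"
      using e by (intro add_mono mult_left_mono start expand) auto
    also have "\<dots> \<le> Phi x (\<lambda>k j. p k j + real m * e * d k j) k j" by (rule Phi_segment_ge[OF x d])
    finally show "p k j + real (Suc m) * e * d k j \<le> Phi x (\<lambda>k j. p k j + real m * e * d k j) k j" .
  qed
qed

section \<open>Integer arithmetic on truncated series\<close>

text \<open>
  A grid lists the rows $k = 1, 2, \dots$ of coefficients $j = 0, 1, \dots$, scaled by $2^{13} = 8192$.
  Products are truncated to the size of the second factor; for nonnegative entries this only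
  loses nonnegative terms. Inequalities are cleared of denominators by
  $2252800 = 275 \cdot 2^{13}$; the constant term carries $67108864 = 2^{26}$, and the same number
  serves as the inverse of the step \<open>e\<close> above.
\<close>

fun row_add :: "int list \<Rightarrow> int list \<Rightarrow> int list" where
  "row_add [] ys = ys"
| "row_add (x # xs) [] = x # xs"
| "row_add (x # xs) (y # ys) = (x + y) # row_add xs ys"

fun row_scale :: "int \<Rightarrow> int list \<Rightarrow> int list" where
  "row_scale a [] = []"
| "row_scale a (x # xs) = a * x # row_scale a xs"

fun row_mult :: "int list \<Rightarrow> int list \<Rightarrow> int list" where
  "row_mult [] ys = []"
| "row_mult (x # xs) [] = []"
| "row_mult (x # xs) (y # ys) = row_add (row_scale x (y # ys)) (0 # row_mult xs (butlast (y # ys)))"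

fun row_le :: "int list \<Rightarrow> int list \<Rightarrow> bool" where
  "row_le [] ys \<longleftrightarrow> True"
| "row_le (x # xs) [] \<longleftrightarrow> x \<le> 0 \<and> row_le xs []"
| "row_le (x # xs) (y # ys) \<longleftrightarrow> x \<le> y \<and> row_le xs ys"

fun grid_add :: "int list list \<Rightarrow> int list list \<Rightarrow> int list list" where
  "grid_add [] ys = ys"
| "grid_add (x # xs) [] = x # xs"
| "grid_add (x # xs) (y # ys) = row_add x y # grid_add xs ys"

fun grid_scale :: "int \<Rightarrow> int list list \<Rightarrow> int list list" where
  "grid_scale a [] = []"
| "grid_scale a (x # xs) = row_scale a x # grid_scale a xs"

fun row_grid_mult :: "int list \<Rightarrow> int list list \<Rightarrow> int list list" where
  "row_grid_mult x [] = []"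
| "row_grid_mult x (y # ys) = row_mult x y # row_grid_mult x ys"

fun grid_mult :: "int list list \<Rightarrow> int list list \<Rightarrow> int list list" where
  "grid_mult [] ys = []"
| "grid_mult (x # xs) [] = []"
| "grid_mult (x # xs) (y # ys) = grid_add (row_grid_mult x (y # ys)) ([] # grid_mult xs (butlast (y # ys)))"

fun grid_le :: "int list list \<Rightarrow> int list list \<Rightarrow> bool" where
  "grid_le [] ys \<longleftrightarrow> True"
| "grid_le (x # xs) [] \<longleftrightarrow> row_le x [] \<and> grid_le xs []"
| "grid_le (x # xs) (y # ys) \<longleftrightarrow> row_le x y \<and> grid_le xs ys"

fun grid_double :: "int list list \<Rightarrow> int list list" where
  "grid_double [] = []"
| "grid_double (x # xs) = row_add x (0 # x) # grid_double xs"

fun grid_N :: "int list \<Rightarrow> int list list \<Rightarrow> int list list" where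
  "grid_N p [] = []"
| "grid_N p [x] = [row_add p (row_scale 2 x)]"
| "grid_N p (x # y # ys) = row_add p (row_add (row_scale 2 x) y) # grid_N x (y # ys)"

definition grid_M :: "int list list \<Rightarrow> int list list" where
  "grid_M p = grid_double (grid_N [] p)"

fun grid_T :: "int list list \<Rightarrow> int list list" where
  "grid_T [] = []"
| "grid_T (x # xs) = row_add x (tl x) # grid_T xs"

definition grid_lin :: "int list list \<Rightarrow> int list list" where
  "grid_lin p = grid_add (grid_M p) ([] # grid_double (butlast p))"

definition grid_bil :: "int list list \<Rightarrow> int list list \<Rightarrow> int list list" where
  "grid_bil p q = [] # grid_mult (grid_M p) (butlast (grid_T q))"

definition grid_Phi :: "int list list \<Rightarrow> int list list" where
  "grid_Phi p = grid_scale 29 (grid_add [[67108864, 67108864]] (grid_add (grid_scale 8192 (grid_lin p)) (grid_bil p p)))"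

definition grid_dPhi :: "int list list \<Rightarrow> int list list \<Rightarrow> int list list" where
  "grid_dPhi p d = grid_scale 29 (grid_add (grid_scale 8192 (grid_lin d)) (grid_add (grid_bil p d) (grid_bil d p)))"

definition fill_step :: "int list list \<Rightarrow> int list list \<Rightarrow> bool" where
  "fill_step p q \<longleftrightarrow> grid_le (grid_scale 2252800 q) (grid_Phi p)"

fun grid_nonneg :: "int list list \<Rightarrow> bool" where
  "grid_nonneg [] \<longleftrightarrow> True"
| "grid_nonneg (x # xs) \<longleftrightarrow> list_all (\<lambda>a. 0 \<le> a) x \<and> grid_nonneg xs"

definition start_test :: "int list list \<Rightarrow> int list list \<Rightarrow> bool" where
  "start_test p d \<longleftrightarrow> grid_le (grid_scale 2252800 (grid_add (grid_scale 67108864 p) d)) (grid_scale 67108864 (grid_Phi p))"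

definition segment_test :: "int list list \<Rightarrow> int list list \<Rightarrow> bool" where
  "segment_test p d \<longleftrightarrow> grid_nonneg d \<and> start_test p d \<and>
     grid_le (grid_scale 2252800 (grid_add (grid_scale 67108864 (grid_add p d)) d))
       (grid_scale 67108864 (grid_add (grid_Phi p) (grid_dPhi p d)))"

definition segment_step :: "int list list \<Rightarrow> int list list \<Rightarrow> bool" where
  "segment_step p q \<longleftrightarrow> segment_test p (grid_add q (grid_scale (- 1) p))"

definition ray_test :: "int list list \<Rightarrow> int list list \<Rightarrow> bool" where
  "ray_test p d \<longleftrightarrow> grid_nonneg d \<and> start_test p d \<and> grid_le (grid_scale 2252800 d) (grid_dPhi p d)"

section \<open>Grid operations as lower bounds for the operators on coefficients\<close>

abbreviation entry :: "int list \<Rightarrow> nat \<Rightarrow> int" where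
  "entry \<equiv> nth_default 0"

text \<open>Rows are numbered from 1 since the series has no v^0 term; everything outside the lists
  counts as 0.\<close>

definition grid_entry :: "int list list \<Rightarrow> nat \<Rightarrow> nat \<Rightarrow> int" where
  "grid_entry p k j = (if k = 0 then 0 else entry (nth_default [] p (k - 1)) j)"

lemma entry_row_add: "entry (row_add x y) j = entry x j + entry y j"
  by (induction x y arbitrary: j rule: row_add.induct) (auto simp: nth_default_Cons split: nat.split)

lemma entry_row_scale: "entry (row_scale a x) j = a * entry x j"
  by (induction a x arbitrary: j rule: row_scale.induct) (auto simp: nth_default_Cons split: nat.split)

lemma nth_default_butlast: "nth_default d (butlast q) i = (if Suc i < length q then nth_default d q i else d)"
  by (auto simp: nth_default_def nth_butlast)

lemma entry_butlast_le:
  assumes "\<And>j. 0 \<le> entry x j"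
  shows "entry (butlast x) j \<le> entry x j"
  using assms[of j] by (simp add: nth_default_butlast)

lemma entry_butlast_nonneg:
  assumes "\<And>j. 0 \<le> entry x j"
  shows "0 \<le> entry (butlast x) j"
  using assms[of j] by (simp add: nth_default_butlast)

lemma entry_tl: "entry (tl x) j = entry x (Suc j)"
  by (cases x) auto

lemma entry_Cons_shift: "entry (0 # x) j = shift (entry x) j"
  by (cases j) auto

lemma entry_row_mult:
  assumes "\<And>j. 0 \<le> entry x j" "\<And>j. 0 \<le> entry y j"
  shows "0 \<le> entry (row_mult x y) j \<and> entry (row_mult x y) j \<le> (\<Sum>l\<le>j. entry x l * entry y (j - l))"
  using assms
proof (induction x y arbitrary: j rule: row_mult.induct)
  case (3 a xs b ys)
  let ?y = "b # ys"
  have a: "0 \<le> a" using 3(2)[of 0] by simp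
  have xs: "0 \<le> entry xs i" for i using 3(2)[of "Suc i"] by simp
  have IH: "0 \<le> entry (row_mult xs (butlast ?y)) i \<and>
      entry (row_mult xs (butlast ?y)) i \<le> (\<Sum>l\<le>i. entry xs l * entry (butlast ?y) (i - l))" for i
    by (rule 3(1)[OF xs entry_butlast_nonneg[OF 3(3)]])
  show ?case
  proof (cases j)
    case 0
    then show ?thesis using a 3(3)[of 0] by (simp add: entry_row_add entry_row_scale)
  next
    case (Suc i)
    have "(\<Sum>l\<le>i. entry xs l * entry (butlast ?y) (i - l)) \<le> (\<Sum>l\<le>i. entry xs l * entry ?y (i - l))"
      by (intro sum_mono mult_left_mono entry_butlast_le 3(3) xs)
    with IH[of i] have "entry (row_mult xs (butlast ?y)) i \<le> (\<Sum>l\<le>i. entry xs l * entry ?y (i - l))"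
      by linarith
    moreover have "entry (row_mult (a # xs) ?y) j = a * entry ?y j + entry (row_mult xs (butlast ?y)) i"
      unfolding row_mult.simps entry_row_add entry_row_scale Suc by simp
    moreover have "(\<Sum>l\<le>j. entry (a # xs) l * entry ?y (j - l)) = a * entry ?y j + (\<Sum>l\<le>i. entry xs l * entry ?y (i - l))"
      unfolding Suc sum.atMost_Suc_shift by simp
    ultimately show ?thesis using IH[of i] a 3(3)[of j] by (simp del: row_mult.simps)
  qed
qed (auto intro!: sum_nonneg)

lemma nth_default_grid_add:
  "entry (nth_default [] (grid_add p q) i) j = entry (nth_default [] p i) j + entry (nth_default [] q i) j"
  by (induction p q arbitrary: i rule: grid_add.induct)
    (auto simp: nth_default_Cons entry_row_add split: nat.split)

lemma grid_entry_add: "grid_entry (grid_add p q) k j = grid_entry p k j + grid_entry q k j"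
  by (simp add: grid_entry_def nth_default_grid_add)

lemma nth_default_grid_scale: "nth_default [] (grid_scale a p) i = row_scale a (nth_default [] p i)"
  by (induction a p arbitrary: i rule: grid_scale.induct) (auto simp: nth_default_Cons split: nat.split)

lemma grid_entry_scale: "grid_entry (grid_scale a p) k j = a * grid_entry p k j"
  by (simp add: grid_entry_def nth_default_grid_scale entry_row_scale)

lemma nth_default_grid_double:
  "entry (nth_default [] (grid_double p) i) j = entry (nth_default [] p i) j + shift (entry (nth_default [] p i)) j"
  by (induction p arbitrary: i rule: grid_double.induct)
    (auto simp: nth_default_Cons entry_row_add entry_Cons_shift shift_def split: nat.split)

lemma nth_default_grid_N:
  "i < length p \<Longrightarrow> entry (nth_default [] (grid_N r p) i) j
    = entry (nth_default [] (r # p) i) j + 2 * entry (nth_default [] p i) j + entry (nth_default [] p (Suc i)) j"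
  by (induction r p arbitrary: i rule: grid_N.induct)
    (auto simp: nth_default_Cons entry_row_add entry_row_scale split: nat.split)

lemma length_grid_N: "length (grid_N r p) = length p"
  by (induction r p rule: grid_N.induct) auto

lemma nth_default_grid_T: "entry (nth_default [] (grid_T p) i) j = entry (nth_default [] p i) j + entry (nth_default [] p i) (Suc j)"
  by (induction p arbitrary: i rule: grid_T.induct)
    (auto simp: nth_default_Cons entry_row_add entry_tl split: nat.split)

lemma grid_entry_T: "grid_entry (grid_T p) k j = op_T (grid_entry p) k j"
  by (simp add: grid_entry_def op_T_def nth_default_grid_T)

lemma grid_entry_Nil: "grid_entry [] k j = 0"
  by (simp add: grid_entry_def)

text \<open>Exact on the rows present; the row just past the last, into which (1+v)^2/v would spill,
  is dropped.\<close>

lemma grid_entry_M: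
  assumes "\<And>k j. 0 \<le> grid_entry p k j"
  shows "0 \<le> grid_entry (grid_M p) k j \<and> grid_entry (grid_M p) k j \<le> op_M (grid_entry p) k j"
proof -
  have N: "0 \<le> grid_entry (grid_N [] p) k j \<and> grid_entry (grid_N [] p) k j \<le> op_N (grid_entry p) k j" for k j
  proof (cases "k = 0 \<or> length p < k")
    case True
    then have "grid_entry (grid_N [] p) k j = 0"
      by (auto simp: grid_entry_def nth_default_def[of "[]"] length_grid_N)
    then show ?thesis using assms by (simp add: op_N_def)
  next
    case False
    then obtain i where k: "k = Suc i" "i < length p" by (cases k) auto
    have "grid_entry (grid_N [] p) k j = op_N (grid_entry p) k j"
      using k by (cases i) (simp_all add: grid_entry_def op_N_def nth_default_grid_N)
    then show ?thesis using assms by (simp add: op_N_def)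
  qed
  have "grid_entry (grid_M p) k j = grid_entry (grid_N [] p) k j + shift (grid_entry (grid_N [] p) k) j"
    by (cases j) (simp_all add: grid_entry_def grid_M_def nth_default_grid_double)
  then show ?thesis using N[of k j] N[of k "j - 1"] by (cases j) (auto simp: op_M_def)
qed

lemma nth_default_row_grid_mult: "nth_default [] (row_grid_mult x q) i = row_mult x (nth_default [] q i)"
proof -
  have "row_mult x [] = []" by (cases x) auto
  then show ?thesis
    by (induction x q arbitrary: i rule: row_grid_mult.induct) (auto simp: nth_default_Cons split: nat.split)
qed

lemma nth_default_grid_mult:
  assumes "\<And>i j. 0 \<le> entry (nth_default [] p i) j" "\<And>i j. 0 \<le> entry (nth_default [] q i) j"
  shows "0 \<le> entry (nth_default [] (grid_mult p q) i) j \<and> entry (nth_default [] (grid_mult p q) i) j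
    \<le> (\<Sum>a\<le>i. \<Sum>l\<le>j. entry (nth_default [] p a) l * entry (nth_default [] q (i - a)) (j - l))"
  using assms
proof (induction p q arbitrary: i rule: grid_mult.induct)
  case (3 x xs y ys)
  let ?y = "y # ys"
  let ?e = "\<lambda>q i. entry (nth_default [] q i)"
  have x: "0 \<le> entry x l" for l using 3(2)[of 0 l] by simp
  have xs: "0 \<le> ?e xs i l" for i l using 3(2)[of "Suc i" l] by simp
  have yb: "0 \<le> ?e (butlast ?y) i l" for i l using 3(3)[of i l] by (simp add: nth_default_butlast del: butlast.simps)
  have IH: "0 \<le> ?e (grid_mult xs (butlast ?y)) i j \<and> ?e (grid_mult xs (butlast ?y)) i j
      \<le> (\<Sum>a\<le>i. \<Sum>l\<le>j. ?e xs a l * ?e (butlast ?y) (i - a) (j - l))" for i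
    by (rule 3(1)[OF xs yb])
  have head: "0 \<le> entry (row_mult x (nth_default [] ?y i)) j \<and> entry (row_mult x (nth_default [] ?y i)) j
      \<le> (\<Sum>l\<le>j. entry x l * ?e ?y i (j - l))" for i
    by (rule entry_row_mult[OF x 3(3)])
  have eq: "?e (grid_mult (x # xs) ?y) i j = entry (row_mult x (nth_default [] ?y i)) j
      + ?e ([] # grid_mult xs (butlast ?y)) i j" for i
    unfolding grid_mult.simps nth_default_grid_add nth_default_row_grid_mult ..
  show ?case
  proof (cases i)
    case 0
    then show ?thesis using head[of 0] eq[of 0] by simp
  next
    case (Suc i')
    have "(\<Sum>a\<le>i'. \<Sum>l\<le>j. ?e xs a l * ?e (butlast ?y) (i' - a) (j - l)) \<le> (\<Sum>a\<le>i'. \<Sum>l\<le>j. ?e xs a l * ?e ?y (i' - a) (j - l))"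
    proof (intro sum_mono mult_left_mono xs)
      fix a l show "?e (butlast ?y) (i' - a) (j - l) \<le> ?e ?y (i' - a) (j - l)"
        using 3(3)[of "i' - a" "j - l"] by (simp add: nth_default_butlast del: butlast.simps)
    qed
    with IH[of i'] have "?e (grid_mult xs (butlast ?y)) i' j \<le> (\<Sum>a\<le>i'. \<Sum>l\<le>j. ?e xs a l * ?e ?y (i' - a) (j - l))"
      by linarith
    moreover have "(\<Sum>a\<le>i. \<Sum>l\<le>j. ?e (x # xs) a l * ?e ?y (i - a) (j - l))
        = (\<Sum>l\<le>j. entry x l * ?e ?y i (j - l)) + (\<Sum>a\<le>i'. \<Sum>l\<le>j. ?e xs a l * ?e ?y (i' - a) (j - l))"
      unfolding Suc sum.atMost_Suc_shift by simp
    moreover have "?e ([] # grid_mult xs (butlast ?y)) i j = ?e (grid_mult xs (butlast ?y)) i' j"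
      unfolding Suc by simp
    ultimately show ?thesis using IH[of i'] head[of i] eq[of i] by linarith
  qed
qed (auto intro!: sum_nonneg)

text \<open>List positions \<open>a\<close> and \<open>b\<close> stand for v^(a+1) and v^(b+1), so
  their product belongs to v^(a+b+2). The leading empty row of \<open>grid_bil\<close> makes up for
  this, and \<open>butlast\<close> keeps the number of rows.\<close>

lemma grid_entry_bil_le:
  assumes p: "\<And>k j. 0 \<le> grid_entry p k j" and q: "\<And>k j. 0 \<le> grid_entry q k j"
  shows "grid_entry (grid_bil p q) k j \<le> op_bil (grid_entry p) (grid_entry q) k j"
proof (cases "k < 2")
  case True
  then consider "k = 0" | "k = 1" by linarith
  then show ?thesis by cases (auto simp: grid_entry_def grid_bil_def op_bil_def)
next
  case False
  then obtain i where k: "k = Suc (Suc i)" by (metis add_2_eq_Suc le_Suc_ex not_less)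
  have M: "0 \<le> entry (nth_default [] (grid_M p) a) l \<and> entry (nth_default [] (grid_M p) a) l \<le> op_M (grid_entry p) (Suc a) l" for a l
    using grid_entry_M[OF p, of "Suc a" l] by (simp add: grid_entry_def)
  have Tge: "0 \<le> op_T (grid_entry q) b l" for b l using q by (simp add: op_T_def)
  have T: "0 \<le> entry (nth_default [] (butlast (grid_T q)) b) l \<and> entry (nth_default [] (butlast (grid_T q)) b) l \<le> op_T (grid_entry q) (Suc b) l" for b l
    using grid_entry_T[of q "Suc b" l] Tge[of "Suc b" l] by (simp add: grid_entry_def nth_default_butlast)
  have "grid_entry (grid_bil p q) k j
      \<le> (\<Sum>a\<le>i. \<Sum>l\<le>j. entry (nth_default [] (grid_M p) a) l * entry (nth_default [] (butlast (grid_T q)) (i - a)) (j - l))"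
    using nth_default_grid_mult[of "grid_M p" "butlast (grid_T q)" i j] M T
    by (simp add: grid_entry_def grid_bil_def k)
  also have "\<dots> \<le> (\<Sum>a\<le>i. \<Sum>l\<le>j. op_M (grid_entry p) (Suc a) l * op_T (grid_entry q) (Suc (i - a)) (j - l))"
    using M T by (intro sum_mono mult_mono) (auto intro: order_trans)
  also have "\<dots> = (\<Sum>a=0..<Suc i. \<Sum>l\<le>j. op_M (grid_entry p) (Suc a) l * op_T (grid_entry q) (k - Suc a) (j - l))"
    unfolding atLeast0LessThan lessThan_Suc_atMost by (intro sum.cong refl) (simp add: k Suc_diff_le)
  also have "\<dots> = op_bil (grid_entry p) (grid_entry q) k j"
    unfolding op_bil_def k One_nat_def sum.shift_bounds_Suc_ivl ..
  finally show ?thesis .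
qed

lemma grid_entry_lin_le:
  assumes p: "\<And>k j. 0 \<le> grid_entry p k j"
  shows "grid_entry (grid_lin p) k j \<le> op_lin (grid_entry p) k j"
proof (cases k)
  case 0
  then show ?thesis by (simp add: grid_entry_def op_lin_def)
next
  case (Suc i)
  have b: "entry (nth_default [] (butlast p) i') l \<le> grid_entry p (Suc i') l" for i' l
    using p[of "Suc i'" l] by (simp add: nth_default_butlast grid_entry_def)
  have "grid_entry ([] # grid_double (butlast p)) k j \<le> grid_entry p i j + shift (grid_entry p i) j"
  proof (cases i)
    case 0
    then show ?thesis by (cases j) (simp_all add: Suc grid_entry_def)
  next
    case (Suc i')
    then show ?thesis using \<open>k = Suc i\<close> b[of i' j] b[of i' "j - 1"]
      by (cases j) (simp_all add: grid_entry_def[of "[] # _"] nth_default_grid_double add_mono)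
  qed
  then show ?thesis
    using grid_entry_M[OF p, of k j] by (simp add: grid_lin_def grid_entry_add op_lin_def Suc)
qed

lemma grid_entry_base: "grid_entry [[a, a]] k j = a * base k j"
  by (auto simp: grid_entry_def base_def nth_default_Cons split: nat.split)

text \<open>Past the end of \<open>x\<close> nothing is compared and \<open>y\<close> may be
  negative there, hence \<open>max 0\<close>.\<close>

lemma entry_row_le: "row_le x y \<Longrightarrow> entry x j \<le> max 0 (entry y j)"
  by (induction x y arbitrary: j rule: row_le.induct)
    (auto simp: nth_default_Cons le_max_iff_disj split: nat.split)

lemma grid_entry_le:
  assumes "grid_le p q"
  shows "grid_entry p k j \<le> max 0 (grid_entry q k j)"
proof -
  have "\<forall>i. row_le (nth_default [] p i) (nth_default [] q i)"
    using assms
    by (induction p q rule: grid_le.induct) (auto simp: nth_default_Cons split: nat.split)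
  then show ?thesis
    by (auto simp: grid_entry_def intro!: entry_row_le)
qed

lemma grid_nonneg_entry: "grid_nonneg p \<Longrightarrow> 0 \<le> grid_entry p k j"
proof -
  assume "grid_nonneg p"
  then have "\<forall>i. list_all (\<lambda>a. 0 \<le> a) (nth_default [] p i)"
    by (induction p rule: grid_nonneg.induct) (auto simp: nth_default_Cons split: nat.split)
  then show ?thesis by (auto simp: grid_entry_def nth_default_def list_all_length)
qed

section \<open>From integer tests to reachability\<close>

definition real_grid :: "int list list \<Rightarrow> nat \<Rightarrow> nat \<Rightarrow> real" where
  "real_grid p k j = real_of_int (grid_entry p k j) / 8192"

lemma op_M_real_grid: "op_M (real_grid p) k j = real_of_int (op_M (grid_entry p) k j) / 8192"
  by (cases j) (simp_all add: op_M_def op_N_def real_grid_def add_divide_distrib)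

lemma op_T_real_grid: "op_T (real_grid p) k j = real_of_int (op_T (grid_entry p) k j) / 8192"
  by (simp add: op_T_def real_grid_def add_divide_distrib)

lemma op_lin_real_grid: "op_lin (real_grid p) k j = real_of_int (op_lin (grid_entry p) k j) / 8192"
  by (cases j) (simp_all add: op_lin_def op_M_real_grid real_grid_def add_divide_distrib)

lemma op_bil_real_grid: "op_bil (real_grid p) (real_grid q) k j = real_of_int (op_bil (grid_entry p) (grid_entry q) k j) / 67108864"
  unfolding op_bil_def op_M_real_grid op_T_real_grid by (simp add: sum_divide_distrib)

text \<open>The constant is 275 * 2^26. Linear terms carry the scale 2^13 once and bilinear ones
  twice, so 2^26 clears both and 275 clears x = 29/275. It also equals 2252800 * 8192, which matches
  the factor in the tests.\<close>

lemma grid_Phi_le: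
  assumes p: "\<And>k j. 0 \<le> grid_entry p k j"
  shows "real_of_int (grid_entry (grid_Phi p) k j) \<le> 18454937600 * Phi (29 / 275) (real_grid p) k j"
proof -
  have "grid_entry (grid_Phi p) k j \<le> 29 * (67108864 * base k j + (8192 * op_lin (grid_entry p) k j + op_bil (grid_entry p) (grid_entry p) k j))"
    unfolding grid_Phi_def grid_entry_scale grid_entry_add grid_entry_base
    using grid_entry_lin_le[OF p, of k j] grid_entry_bil_le[OF p p, of k j] by simp
  then have "real_of_int (grid_entry (grid_Phi p) k j)
      \<le> real_of_int (29 * (67108864 * base k j + (8192 * op_lin (grid_entry p) k j + op_bil (grid_entry p) (grid_entry p) k j)))"
    by (simp only: of_int_le_iff)
  also have "\<dots> = 18454937600 * Phi (29 / 275) (real_grid p) k j"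
    by (simp add: Phi_def op_lin_real_grid op_bil_real_grid base_def field_simps)
  finally show ?thesis .
qed

lemma grid_dPhi_le:
  assumes p: "\<And>k j. 0 \<le> grid_entry p k j" and d: "\<And>k j. 0 \<le> grid_entry d k j"
  shows "real_of_int (grid_entry (grid_dPhi p d) k j) \<le> 18454937600 * dPhi (29 / 275) (real_grid p) (real_grid d) k j"
proof -
  have "grid_entry (grid_dPhi p d) k j \<le> 29 * (8192 * op_lin (grid_entry d) k j
      + (op_bil (grid_entry p) (grid_entry d) k j + op_bil (grid_entry d) (grid_entry p) k j))"
    unfolding grid_dPhi_def grid_entry_scale grid_entry_add
    using grid_entry_lin_le[OF d, of k j] grid_entry_bil_le[OF p d, of k j] grid_entry_bil_le[OF d p, of k j] by simp
  then have "real_of_int (grid_entry (grid_dPhi p d) k j) \<le> real_of_int (29 * (8192 * op_lin (grid_entry d) k j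
      + (op_bil (grid_entry p) (grid_entry d) k j + op_bil (grid_entry d) (grid_entry p) k j)))"
    by (simp only: of_int_le_iff)
  also have "\<dots> = 18454937600 * dPhi (29 / 275) (real_grid p) (real_grid d) k j"
    by (simp add: dPhi_def op_lin_real_grid op_bil_real_grid field_simps)
  finally show ?thesis .
qed

lemma grid_le_real:
  assumes "grid_le p q" "real_of_int (grid_entry q k j) \<le> B" "0 \<le> B"
  shows "real_of_int (grid_entry p k j) \<le> B"
proof -
  have "real_of_int (grid_entry p k j) \<le> real_of_int (max 0 (grid_entry q k j))"
    using grid_entry_le[OF assms(1)] by (simp only: of_int_le_iff)
  with assms(2,3) show ?thesis by (simp add: max_def split: if_splits)
qed

lemma real_grid_nonneg: "grid_nonneg p \<Longrightarrow> 0 \<le> real_grid p k j"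
  by (simp add: real_grid_def grid_nonneg_entry)

lemma Phi_real_grid_nonneg: "grid_nonneg p \<Longrightarrow> 0 \<le> Phi (29 / 275) (real_grid p) k j"
  by (auto simp: Phi_def base_def intro!: add_nonneg_nonneg op_lin_nonneg op_bil_nonneg real_grid_nonneg)

lemma dPhi_real_grid_nonneg:
  "grid_nonneg p \<Longrightarrow> grid_nonneg d \<Longrightarrow> 0 \<le> dPhi (29 / 275) (real_grid p) (real_grid d) k j"
  by (auto simp: dPhi_def intro!: add_nonneg_nonneg op_lin_nonneg op_bil_nonneg real_grid_nonneg)

lemma fill_step_reachable:
  assumes "fill_step p q" "grid_nonneg p" "reachable (29 / 275) (real_grid p)"
  shows "reachable (29 / 275) (real_grid q)"
proof (rule reachable_step[OF _ assms(3) real_grid_nonneg[OF assms(2)]])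
  fix k j
  have "real_of_int (grid_entry (grid_scale 2252800 q) k j) \<le> 18454937600 * Phi (29 / 275) (real_grid p) k j"
    by (rule grid_le_real[OF assms(1)[unfolded fill_step_def] grid_Phi_le])
      (simp_all add: assms(2) grid_nonneg_entry Phi_real_grid_nonneg)
  then show "real_grid q k j \<le> Phi (29 / 275) (real_grid p) k j"
    by (simp add: grid_entry_scale real_grid_def)
qed simp

lemma start_test_real:
  assumes "start_test p d" "grid_nonneg p"
  shows "real_grid p k j + 1 / 67108864 * real_grid d k j \<le> Phi (29 / 275) (real_grid p) k j"
proof -
  have "real_of_int (grid_entry (grid_scale 2252800 (grid_add (grid_scale 67108864 p) d)) k j)
      \<le> 67108864 * (18454937600 * Phi (29 / 275) (real_grid p) k j)"
    by (rule grid_le_real[OF assms(1)[unfolded start_test_def]])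
      (simp_all add: assms(2) grid_nonneg_entry Phi_real_grid_nonneg grid_entry_scale grid_Phi_le)
  then show ?thesis
    by (simp add: grid_entry_scale grid_entry_add real_grid_def field_simps)
qed

lemma segment_step_reachable:
  assumes "segment_step p q" "grid_nonneg p" "reachable (29 / 275) (real_grid p)"
  shows "reachable (29 / 275) (real_grid q)"
proof -
  define d where "d = grid_add q (grid_scale (- 1) p)"
  have d: "grid_nonneg d" "start_test p d"
    "grid_le (grid_scale 2252800 (grid_add (grid_scale 67108864 (grid_add p d)) d))
       (grid_scale 67108864 (grid_add (grid_Phi p) (grid_dPhi p d)))"
    using assms(1) by (simp_all add: segment_step_def segment_test_def d_def)
  have "reachable (29 / 275) (\<lambda>k j. real_grid p k j + real_grid d k j)"
  proof (rule reachable_segment[where e = "1 / 67108864"])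
    fix k j
    have "real_of_int (grid_entry (grid_scale 2252800 (grid_add (grid_scale 67108864 (grid_add p d)) d)) k j)
        \<le> 67108864 * (18454937600 * Phi (29 / 275) (real_grid p) k j
            + 18454937600 * dPhi (29 / 275) (real_grid p) (real_grid d) k j)"
    proof (rule grid_le_real[OF d(3)])
      show "real_of_int (grid_entry (grid_scale 67108864 (grid_add (grid_Phi p) (grid_dPhi p d))) k j)
          \<le> 67108864 * (18454937600 * Phi (29 / 275) (real_grid p) k j
            + 18454937600 * dPhi (29 / 275) (real_grid p) (real_grid d) k j)"
        using grid_Phi_le[of p k j] grid_dPhi_le[of p d k j] assms(2) d(1)
        by (simp add: grid_entry_scale grid_entry_add grid_nonneg_entry)
    qed (simp add: assms(2) d(1) Phi_real_grid_nonneg dPhi_real_grid_nonneg)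
    then show "real_grid p k j + real_grid d k j + 1 / 67108864 * real_grid d k j
        \<le> Phi (29 / 275) (real_grid p) k j + dPhi (29 / 275) (real_grid p) (real_grid d) k j"
      by (simp add: grid_entry_scale grid_entry_add real_grid_def field_simps)
  qed (use assms(2,3) d start_test_real real_grid_nonneg in auto)
  moreover have "real_grid p k j + real_grid d k j = real_grid q k j" for k j
    by (simp add: real_grid_def d_def grid_entry_add grid_entry_scale field_simps)
  ultimately show ?thesis by simp
qed

lemma ray_test_reachable:
  assumes "ray_test p d" "grid_nonneg p" "reachable (29 / 275) (real_grid p)"
  shows "reachable (29 / 275) (\<lambda>k j. real_grid p k j + (real m * (1 / 67108864)) * real_grid d k j)"
proof (rule reachable_ray)
  have d: "grid_nonneg d" "start_test p d" "grid_le (grid_scale 2252800 d) (grid_dPhi p d)"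
    using assms(1) by (simp_all add: ray_test_def)
  fix k j
  have "real_of_int (grid_entry (grid_scale 2252800 d) k j) \<le> 18454937600 * dPhi (29 / 275) (real_grid p) (real_grid d) k j"
    by (rule grid_le_real[OF d(3) grid_dPhi_le])
      (simp_all add: assms(2) d(1) grid_nonneg_entry dPhi_real_grid_nonneg)
  then show "real_grid d k j \<le> dPhi (29 / 275) (real_grid p) (real_grid d) k j"
    by (simp add: grid_entry_scale real_grid_def)
  show "0 \<le> real_grid d k j" by (rule real_grid_nonneg[OF d(1)])
  show "real_grid p k j + 1 / 67108864 * real_grid d k j \<le> Phi (29 / 275) (real_grid p) k j"
    by (rule start_test_real[OF d(2) assms(2)])
qed (use assms(2,3) real_grid_nonneg in auto)

section \<open>The certificate\<close>

text \<open>
  Found numerically, rounded down: four plain iterates from 0, then three Newton steps, at the slightly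
  smaller $x = 1/9.505$, which leaves room for the rounding. At \<open>grid7\<close> the derivative of \<open>Phi\<close>
  has spectral radius above 1, with approximate Perron vector \<open>direction\<close>.
\<close>

definition grid1 :: "int list list" where
  "grid1 =
    [[768, 768, 0, 0, 0, 0, 0],
     [0, 0, 0, 0, 0, 0, 0],
     [0, 0, 0, 0, 0, 0, 0],
     [0, 0, 0, 0, 0, 0, 0],
     [0, 0, 0, 0, 0, 0, 0],
     [0, 0, 0, 0, 0, 0, 0],
     [0, 0, 0, 0, 0, 0, 0],
     [0, 0, 0, 0, 0, 0, 0],
     [0, 0, 0, 0, 0, 0, 0],
     [0, 0, 0, 0, 0, 0, 0],
     [0, 0, 0, 0, 0, 0, 0],
     [0, 0, 0, 0, 0, 0, 0],
     [0, 0, 0, 0, 0, 0, 0]]"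

definition grid2 :: "int list list" where
  "grid2 =
    [[896, 1024, 160, 0, 0, 0, 0],
     [160, 384, 192, 14, 0, 0, 0],
     [14, 32, 28, 7, 0, 0, 0],
     [0, 0, 0, 0, 0, 0, 0],
     [0, 0, 0, 0, 0, 0, 0],
     [0, 0, 0, 0, 0, 0, 0],
     [0, 0, 0, 0, 0, 0, 0],
     [0, 0, 0, 0, 0, 0, 0],
     [0, 0, 0, 0, 0, 0, 0],
     [0, 0, 0, 0, 0, 0, 0],
     [0, 0, 0, 0, 0, 0, 0],
     [0, 0, 0, 0, 0, 0, 0],
     [0, 0, 0, 0, 0, 0, 0]]"

definition grid3 :: "int list list" where
  "grid3 =
    [[1024, 1280, 256, 48, 1, 0, 0],
     [256, 640, 512, 128, 16, 1, 0],
     [80, 256, 256, 128, 32, 3, 0],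
     [16, 56, 80, 56, 20, 3, 0],
     [2, 8, 16, 14, 6, 1, 0],
     [0, 0, 1, 1, 1, 0, 0],
     [0, 0, 0, 0, 0, 0, 0],
     [0, 0, 0, 0, 0, 0, 0],
     [0, 0, 0, 0, 0, 0, 0],
     [0, 0, 0, 0, 0, 0, 0],
     [0, 0, 0, 0, 0, 0, 0],
     [0, 0, 0, 0, 0, 0, 0],
     [0, 0, 0, 0, 0, 0, 0]]"

definition grid4 :: "int list list" where
  "grid4 =
    [[1024, 1280, 384, 128, 24, 1, 0],
     [320, 896, 768, 320, 96, 20, 2],
     [128, 512, 640, 512, 192, 56, 10],
     [56, 256, 384, 384, 224, 80, 20],
     [20, 96, 192, 192, 160, 64, 24],
     [5, 28, 64, 80, 80, 48, 20],
     [1, 7, 20, 28, 28, 20, 10],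
     [0, 1, 4, 8, 8, 7, 4],
     [0, 0, 0, 1, 2, 2, 1],
     [0, 0, 0, 0, 0, 0, 0],
     [0, 0, 0, 0, 0, 0, 0],
     [0, 0, 0, 0, 0, 0, 0],
     [0, 0, 0, 0, 0, 0, 0]]"

definition grid5 :: "int list list" where
  "grid5 =
    [[1156, 1687, 1089, 1453, 2677, 5740, 12856],
     [485, 1678, 3124, 5606, 11572, 26152, 58864],
     [386, 2070, 6072, 14732, 35056, 85216, 196416],
     [418, 2883, 10952, 32632, 88768, 233728, 557568],
     [527, 4264, 19176, 66240, 201792, 573696, 1421824],
     [722, 6520, 33040, 127840, 428032, 1305088, 3357696],
     [1045, 10188, 56464, 238912, 865792, 2807808, 7471104],
     [1567, 16176, 96128, 437248, 1692672, 5785600, 15851520],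
     [2413, 26016, 163328, 787456, 3220480, 11497472, 32251904],
     [3783, 42144, 276096, 1394688, 5959680, 22028288, 62816256],
     [5960, 67936, 459136, 2400256, 10604544, 40173568, 115408896],
     [9112, 104864, 721152, 3854336, 17375232, 66715648, 190709760],
     [11668, 132864, 914176, 4917248, 22315008, 85688320, 239337472]]"

definition grid6 :: "int list list" where
  "grid6 =
    [[1157, 1709, 1250, 2463, 8556, 38032, 162688],
     [498, 1821, 4142, 11840, 47456, 220864, 924160],
     [437, 2668, 10532, 42800, 199360, 979200, 4090880],
     [582, 4962, 27408, 141056, 742656, 3835904, 16150528],
     [1012, 10812, 74240, 448000, 2585600, 13934592, 59211776],
     [2101, 26104, 207104, 1393152, 8597504, 47906816, 205389824],
     [4882, 67104, 586496, 4253696, 27566080, 157548544, 679477248],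
     [12160, 178560, 1666048, 12730368, 85393408, 496893952, 2149580800],
     [31392, 480896, 4683776, 37076992, 254803968, 1499987968, 6486491136],
     [81632, 1281536, 12820480, 103841792, 724566016, 4293918720, 18488492032],
     [206912, 3280896, 33284096, 273154048, 1922564096, 11404312576, 48704258048],
     [481792, 7618560, 77594624, 639893504, 4513071104, 26675773440, 112373792768],
     [867840, 13504512, 136773632, 1125646336, 7916748800, 46389002240, 191260262400]]"

definition grid7 :: "int list list" where
  "grid7 =
    [[1158, 1713, 1317, 3262, 16552, 105120, 580096],
     [499, 1853, 4610, 17240, 100448, 655360, 3487744],
     [445, 2844, 13020, 71136, 473856, 3192832, 16801792],
     [621, 5806, 39184, 273920, 2016768, 13991936, 73728000],
     [1191, 14568, 126016, 1027584, 8103936, 57606144, 305004544],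
     [2856, 41808, 422016, 3784704, 31260672, 226492416, 1205338112],
     [7912, 129504, 1435136, 13660160, 116424704, 855638016, 4578082816],
     [23728, 414720, 4859904, 48037888, 418119680, 3105882112, 16689135616],
     [73376, 1330688, 16121856, 163119104, 1441267712, 10787749888, 58166607872],
     [225344, 4161536, 51396608, 527958016, 4710203392, 35467034624, 191730024448],
     [660992, 12279808, 153223168, 1589116928, 14273216512, 107877498880, 584115552256],
     [1742336, 32260096, 403963904, 4213178368, 38017171456, 288165462016, 1561220612096],
     [3467264, 63422464, 793772032, 8302624768, 75094818816, 570156908544, 3088081485824]]"

definition direction :: "int list list" where
  "direction =
    [[3, 86, 1374, 17536, 190720, 1734656, 11534336],
     [26, 622, 9584, 120064, 1284096, 11419648, 72220672],
     [149, 3416, 51712, 641024, 6782976, 59506688, 368050176],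
     [742, 16640, 249088, 3063808, 32243712, 281018368, 1730150400],
     [3404, 75264, 1118208, 13713408, 143917056, 1254096896, 7717519360],
     [14720, 322560, 4775936, 58392576, 613416960, 5351931904, 33051115520],
     [60672, 1320960, 19464192, 238288896, 2503999488, 21944598528, 136230993920],
     [238848, 5160960, 76021760, 931135488, 9831448576, 86436216832, 540629008384],
     [894976, 19234816, 282591232, 3472883712, 36775657472, 325880643584, 2050846883840],
     [3166208, 67502080, 993001472, 12230590464, 130325413888, 1159641169920, 7361573945344],
     [10321920, 218890240, 3217031168, 39795556352, 425738633216, 3818225926144, 24464133718016],
     [29556736, 620756992, 9126805504, 113279762432, 1219770712064, 11029476016128, 71330816851968],
     [62652416, 1300234240, 19126026240, 238639120384, 2585570312192, 23570780520448, 154206505795584]]"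

lemma fill_steps:
  "fill_step [] grid1" "fill_step grid1 grid2" "fill_step grid2 grid3" "fill_step grid3 grid4"
  by code_simp+

lemma segment_step_4_5: "segment_step grid4 grid5"
  by code_simp

lemma segment_step_5_6: "segment_step grid5 grid6"
  by code_simp

lemma segment_step_6_7: "segment_step grid6 grid7"
  by code_simp

lemma ray_test_7: "ray_test grid7 direction"
  by code_simp

lemma grids_nonneg:
  "grid_nonneg grid1" "grid_nonneg grid2" "grid_nonneg grid3" "grid_nonneg grid4"
  "grid_nonneg grid5" "grid_nonneg grid6" "grid_nonneg grid7"
  by code_simp+

text \<open>The coefficient of v^1 u^0 is the one that bounds \<open>W3\<close> from below, so the
  ray must move it.\<close>

lemma direction_entry: "grid_entry direction 1 0 > 0"
  by (simp add: grid_entry_def direction_def)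


lemma reachable_grid7: "reachable (29 / 275) (real_grid grid7)"
proof -
  have "reachable (29 / 275) (real_grid [])"
    unfolding reachable_def by (intro exI[of _ 0]) (simp add: real_grid_def grid_entry_Nil partial_gf_def)
  then show ?thesis
    by (meson fill_step_reachable fill_steps segment_step_reachable segment_step_4_5
        segment_step_5_6 segment_step_6_7 grids_nonneg grid_nonneg.simps(1))
qed

text \<open>Along the ray from \<open>grid7\<close> the coefficient of v^1 u^0 grows linearly in
  \<open>m\<close>, and every point of the ray reached lies below some partial sum.\<close>

lemma W3_gf_unbounded: "\<exists>N. C < (\<Sum>n=1..N. real (W3 n) * (29 / 275) ^ n)"
proof -
  have d: "real_grid direction 1 0 > 0" using direction_entry by (simp add: real_grid_def)
  obtain m where m: "C < real m * (1 / 67108864 * real_grid direction 1 0)"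
    using d reals_Archimedean3[of "1 / 67108864 * real_grid direction 1 0"] by auto
  obtain N where N: "\<And>k j. real_grid grid7 k j + (real m * (1 / 67108864)) * real_grid direction k j
      \<le> partial_gf (29 / 275) N k j"
    using ray_test_reachable[OF ray_test_7 grids_nonneg(7) reachable_grid7, of m]
    unfolding reachable_def by blast
  have "C < real_grid grid7 1 0 + (real m * (1 / 67108864)) * real_grid direction 1 0"
    using m real_grid_nonneg[OF grids_nonneg(7), of 1 0] by simp
  also have "\<dots> \<le> partial_gf (29 / 275) N 1 0" by (rule N)
  also have "\<dots> \<le> (\<Sum>n=1..N. real (W3 n) * (29 / 275) ^ n)"
    unfolding partial_gf_def using weight_le_W3 by (intro sum_mono mult_right_mono) auto
  finally show ?thesis by blast
qed

section \<open>Comparison with the binomial coefficients\<close>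

lemma stack_sort_upt: "stack_sort [1..<Suc n] = [1..<Suc n]"
proof (induction n)
  case (Suc n)
  have "stack_sort ([1..<Suc n] @ [Suc n]) = stack_sort [1..<Suc n] @ [Suc n]"
    by (intro stack_sort_snoc_max) auto
  with Suc show ?case by simp
qed simp

lemma W3_pos: "0 < W3 n"
proof -
  let ?S = "{p \<in> permutations_of_set {1..n}. three_stack_sortable p}"
  have "three_stack_sortable [1..<Suc n]"
    unfolding three_stack_sortable_def stack_sort_upt by (rule sorted_wrt_upt)
  then have "[1..<Suc n] \<in> ?S"
    by (simp add: permutations_of_set_def atLeastLessThanSuc_atLeastAtMost del: upt_Suc)
  moreover have "finite ?S" by simp
  ultimately show ?thesis unfolding W3_def by (metis (no_types, lifting) card_gt_0_iff empty_iff)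
qed

text \<open>A single term of the expansion of (1/4 + 3/4)^(4n) is at most 1, and 4^4 / 3^3 =
  256/27.\<close>

lemma binomial_4n_le: "real ((4 * n) choose n) \<le> (256 / 27) ^ n"
proof -
  have "real ((4 * n) choose n) * (1 / 4) ^ n * (3 / 4) ^ (4 * n - n)
      \<le> (\<Sum>k\<le>4 * n. real ((4 * n) choose k) * (1 / 4) ^ k * (3 / 4) ^ (4 * n - k))"
    by (rule member_le_sum) auto
  also have "\<dots> = (1 / 4 + 3 / 4) ^ (4 * n)" by (rule binomial_ring[symmetric])
  finally have "real ((4 * n) choose n) * ((1 / 4) ^ n * (3 / 4) ^ (3 * n)) \<le> 1" by (simp add: mult.assoc)
  also have "(1 / 4) ^ n * (3 / 4) ^ (3 * n) = (27 / 256 :: real) ^ n"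
    unfolding power_mult power_mult_distrib[symmetric] by (simp add: power_divide)
  finally have "real ((4 * n) choose n) \<le> 1 / (27 / 256) ^ n" by (simp add: pos_le_divide_eq)
  also have "\<dots> = (256 / 27) ^ n" by (simp add: power_divide)
  finally show ?thesis .
qed

theorem theorem12:
  assumes "mono_on {1..} (\<lambda>n. real (W3 (n + 1)) / real (W3 n))"
  shows "\<exists>N. \<forall>n\<ge>N. W3 n > (4 * n) choose n"
proof -
  have "\<exists>m\<ge>1. 256 / 27 < real (W3 (m + 1)) / real (W3 m)"
  proof (rule ccontr)
    assume "\<not> ?thesis"
    then have ratio: "real (W3 (n + 1)) \<le> 256 / 27 * real (W3 n)" if "n \<ge> 1" for n
      using that W3_pos[of n] by (auto simp: not_less divide_le_eq)
    have bound: "real (W3 (Suc n)) \<le> real (W3 1) * (256 / 27) ^ n" for n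
    proof (induction n)
      case (Suc n)
      then show ?case using ratio[of "Suc n"] by simp
    qed simp
    \<comment> \<open>The geometric ratio is (256/27) (29/275) = 7424/7425 < 1, so the geometric
      series stays below 7425.\<close>
    have "(\<Sum>n=1..N. real (W3 n) * (29 / 275) ^ n) \<le> 29 / 275 * real (W3 1) * 7425" for N
    proof -
      have "(\<Sum>n=1..N. real (W3 n) * (29 / 275) ^ n) = (\<Sum>n<N. real (W3 (Suc n)) * (29 / 275) ^ Suc n)"
        by (rule sum.reindex_bij_witness[of _ Suc "\<lambda>n. n - 1"]) auto
      also have "\<dots> \<le> (\<Sum>n<N. 29 / 275 * real (W3 1) * (7424 / 7425) ^ n)"
      proof (rule sum_mono)
        fix n
        have "real (W3 (Suc n)) * (29 / 275) ^ Suc n \<le> real (W3 1) * (256 / 27) ^ n * (29 / 275) ^ Suc n"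
          by (intro mult_right_mono bound) simp
        also have "\<dots> = 29 / 275 * real (W3 1) * ((256 / 27) * (29 / 275)) ^ n"
          unfolding power_mult_distrib by simp
        finally show "real (W3 (Suc n)) * (29 / 275) ^ Suc n \<le> 29 / 275 * real (W3 1) * (7424 / 7425) ^ n"
          by simp
      qed
      also have "\<dots> = 29 / 275 * real (W3 1) * (\<Sum>n<N. (7424 / 7425) ^ n)"
        by (simp add: sum_distrib_left)
      also have "(\<Sum>n<N. (7424 / 7425 :: real) ^ n) = 7425 * (1 - (7424 / 7425) ^ N)"
        by (subst sum_gp_strict) simp
      also have "29 / 275 * real (W3 1) * (7425 * (1 - (7424 / 7425) ^ N)) \<le> 29 / 275 * real (W3 1) * 7425"
        by (intro mult_left_mono) auto
      finally show ?thesis .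
    qed
    moreover obtain N where "29 / 275 * real (W3 1) * 7425 < (\<Sum>n=1..N. real (W3 n) * (29 / 275) ^ n)"
      using W3_gf_unbounded by blast
    ultimately show False using not_less by blast
  qed
  then obtain m where m: "m \<ge> 1" "256 / 27 < real (W3 (m + 1)) / real (W3 m)" by blast
  define r where "r = real (W3 (m + 1)) / real (W3 m)"
  have r: "256 / 27 < r" using m by (simp add: r_def)
  have grow: "real (W3 m) * r ^ i \<le> real (W3 (m + i))" for i
  proof (induction i)
    case (Suc i)
    have "r \<le> real (W3 (m + i + 1)) / real (W3 (m + i))"
      unfolding r_def using m(1) by (intro mono_onD[OF assms]) auto
    then have "r * real (W3 (m + i)) \<le> real (W3 (m + Suc i))"
      using W3_pos[of "m + i"] by (simp add: pos_le_divide_eq)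
    moreover have "r * (real (W3 m) * r ^ i) \<le> r * real (W3 (m + i))"
      using Suc r by (intro mult_left_mono) auto
    ultimately show ?case by (simp add: mult_ac)
  qed simp
  \<comment> \<open>The factor by which all ratios from \<open>m\<close> on exceed 256/27; a power
    of it outweighs the constant lost on the first \<open>m\<close> terms.\<close>
  define q where "q = r / (256 / 27)"
  have q: "1 < q" using r by (simp add: q_def)
  obtain i0 where i0: "(256 / 27) ^ m / real (W3 m) < q ^ i0"
    using real_arch_pow[OF q] by blast
  have "(4 * n) choose n < W3 n" if n: "n \<ge> m + i0" for n
  proof -
    define i where "i = n - m"
    have i: "n = m + i" "i0 \<le> i" using n by (auto simp: i_def)
    have "(256 / 27) ^ m / real (W3 m) < q ^ i"
      using i0 power_increasing[OF i(2) less_imp_le[OF q]] by (rule less_le_trans)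
    then have "(256 / 27) ^ m < real (W3 m) * q ^ i"
      using W3_pos[of m] by (simp add: divide_less_eq mult.commute)
    then have "(256 / 27) ^ m * (256 / 27) ^ i < real (W3 m) * q ^ i * (256 / 27) ^ i"
      by (intro mult_strict_right_mono) auto
    also have "\<dots> = real (W3 m) * r ^ i"
      by (simp add: q_def mult.assoc power_mult_distrib[symmetric])
    also have "\<dots> \<le> real (W3 n)" using grow[of i] i by simp
    finally have "(256 / 27) ^ n < real (W3 n)" by (simp add: i power_add)
    with binomial_4n_le[of n] have "real ((4 * n) choose n) < real (W3 n)" by linarith
    then show ?thesis by (simp only: of_nat_less_iff)
  qed
  then show ?thesis by blast
qed

end
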